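(* Let $a,b>0$ and $f\in L^2(\mathbb R)$ be such that $\{E_{mb}\mathcal T_{na}f\}_{m,n\in\mathbb Z}$ is a Riesz basis for $L^2(\mathbb R)$. Then the adjoint Gabor system $\left\{\frac{1}{\sqrt{ab}}E_{\frac ma}\mathcal T_{\frac nb}f\right\}_{m,n\in\mathbb Z}$ is a weak R-dual of $\{E_{mb}\mathcal T_{na}f\}_{m,n\in\mathbb Z}$ only in the sense of an R-dual; that is, the adjoint Gabor system is an R-dual (hence a weak R-dual) of $\{E_{mb}\mathcal T_{na}f\}_{m,n\in\mathbb Z}$, and whenever it is a weak R-dual of $\{E_{mb}\mathcal T_{na}f\}_{m,n\in\mathbb Z}$ with respect to Parseval frames $u=\{u_{mn}\}_{m,n\in\mathbb Z}$ and $v=\{v_{mn}\}_{m,n\in\mathbb Z}$ for $L^2(\mathbb R)$, both $u$ and $v$ are orthonormal bases of $L^2(\mathbb R)$.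
   Context: For $x\in\mathbb R$, $(E_xg)(t)=e^{2\pi ixt}g(t)$ and $(\mathcal T_xg)(t)=g(t-x)$ on $L^2(\mathbb R)$. All sequences here are indexed by $I=\mathbb Z\times\mathbb Z$. Inner products are linear in the first variable. A sequence $\{f_i\}_{i\in I}$ in a Hilbert space $H$ is a Parseval frame for $H$ if $\sum_{i}|\langle x,f_i\rangle|^2=\|x\|^2$ for all $x\in H$. It is a Riesz basis for $H$ if its closed linear span is $H$ and there are $0<A\le B<\infty$ with $A\|c\|^2\le\|\sum_i c_if_i\|^2\le B\|c\|^2$ for all finite scalar sequences $c$ (norm of $c$ in $\ell^2(I)$). Weak R-dual: let $u=\{u_i\}_{i\in I},v=\{v_i\}_{i\in I}$ be Parseval frames for $H$ and $f=\{f_i\}_{i\in I}$ a sequence in $H$ such that $\sum_{i\in I}|\langle f_i,u_j\rangle|^2<\infty$ for all $j\in I$ and $\sum_{k\in I}\langle v_k,v_i\rangle\langle f_k,u_j\rangle=\langle f_i,u_j\rangle$ for all $i,j\in I$. Then $w=\{w_j\}_{j\in I}$ given by $w_j=\sum_{i\in I}\langle f_i,u_j\rangle v_i$ is called the weak R-dual of $f$ with respect to $u$ and $v$. R-dual: if $u,v$ are orthonormal bases of $H$ and $\sum_{i}|\langle f_i,u_j\rangle|^2<\infty$ for all $j$, then $w_j=\sum_{i\in I}\langle f_i,u_j\rangle v_i$, $j\in I$, is the R-dual of $f$ with respect to $u$ and $v$. *)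

theory Defs
  imports "HOL-Analysis.Analysis"
begin

section \<open>Complex Hilbert spaces\<close>

text \<open>The complex inner product is linear in its first argument. The real inner product, norm and
  topology of the library are kept, as the underlying real structure.\<close>

class complex_inner = real_inner +
  fixes scaleC :: "complex \<Rightarrow> 'a \<Rightarrow> 'a" (infixr "*\<^sub>C" 75)
    and cinner :: "'a \<Rightarrow> 'a \<Rightarrow> complex"
  assumes scaleC_add_right: "c *\<^sub>C (x + y) = c *\<^sub>C x + c *\<^sub>C y"
    and scaleC_add_left: "(c + d) *\<^sub>C x = c *\<^sub>C x + d *\<^sub>C x"
    and scaleC_scaleC: "c *\<^sub>C (d *\<^sub>C x) = (c * d) *\<^sub>C x"
    and scaleR_scaleC: "r *\<^sub>R x = complex_of_real r *\<^sub>C x"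
    and cinner_commute: "cinner x y = cnj (cinner y x)"
    and cinner_add_left: "cinner (x + y) z = cinner x z + cinner y z"
    and cinner_scaleC_left: "cinner (c *\<^sub>C x) y = c * cinner x y"
    and inner_eq_Re_cinner: "inner x y = Re (cinner x y)"

class chilbert_space = complex_inner + complete_space

global_interpretation complex_vector: vector_space "scaleC :: complex \<Rightarrow> 'a \<Rightarrow> 'a::complex_inner"
  defines cspan = complex_vector.span
proof unfold_locales
  show "1 *\<^sub>C x = x" for x :: 'a
    using scaleR_scaleC[of 1 x] by simp
qed (simp_all add: scaleC_add_right scaleC_add_left scaleC_scaleC)

section \<open>Frames, bases and R-duals\<close>

text \<open>All infinite sums are unordered (\<open>has_sum\<close>, in the norm for vector-valued sums). The
  argument \<open>w\<close> of the two dual predicates is the dual of the sequence \<open>f\<close> with respect to \<open>u\<close>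
  and \<open>v\<close>.\<close>

definition parseval_frame :: "('i \<Rightarrow> 'a::chilbert_space) \<Rightarrow> bool" where
  "parseval_frame f \<longleftrightarrow>
     (\<forall>x. ((\<lambda>i. (cmod (cinner x (f i)))\<^sup>2) has_sum (norm x)\<^sup>2) UNIV)"

definition riesz_basis :: "('i \<Rightarrow> 'a::chilbert_space) \<Rightarrow> bool" where
  "riesz_basis f \<longleftrightarrow>
     closure (cspan (range f)) = UNIV \<and>
     (\<exists>A B. 0 < A \<and> A \<le> B \<and>
       (\<forall>(F :: 'i set) (c :: 'i \<Rightarrow> complex). finite F \<longrightarrow>
          A * (\<Sum>i\<in>F. (cmod (c i))\<^sup>2) \<le> (norm (\<Sum>i\<in>F. c i *\<^sub>C f i))\<^sup>2 \<and>
          (norm (\<Sum>i\<in>F. c i *\<^sub>C f i))\<^sup>2 \<le> B * (\<Sum>i\<in>F. (cmod (c i))\<^sup>2)))"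

definition orthonormal_basis :: "('i \<Rightarrow> 'a::chilbert_space) \<Rightarrow> bool" where
  "orthonormal_basis f \<longleftrightarrow>
     (\<forall>i j. cinner (f i) (f j) = (if i = j then 1 else 0)) \<and>
     closure (cspan (range f)) = UNIV"

definition is_weak_R_dual ::
  "('i \<Rightarrow> 'a::chilbert_space) \<Rightarrow> ('i \<Rightarrow> 'a) \<Rightarrow> ('i \<Rightarrow> 'a) \<Rightarrow> ('i \<Rightarrow> 'a) \<Rightarrow> bool" where
  "is_weak_R_dual w f u v \<longleftrightarrow>
     parseval_frame u \<and> parseval_frame v \<and>
     (\<forall>j. (\<lambda>i. (cmod (cinner (f i) (u j)))\<^sup>2) summable_on UNIV) \<and>
     (\<forall>i j. ((\<lambda>k. cinner (v k) (v i) * cinner (f k) (u j)) has_sum cinner (f i) (u j)) UNIV) \<and>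
     (\<forall>j. ((\<lambda>i. cinner (f i) (u j) *\<^sub>C v i) has_sum w j) UNIV)"

definition is_R_dual ::
  "('i \<Rightarrow> 'a::chilbert_space) \<Rightarrow> ('i \<Rightarrow> 'a) \<Rightarrow> ('i \<Rightarrow> 'a) \<Rightarrow> ('i \<Rightarrow> 'a) \<Rightarrow> bool" where
  "is_R_dual w f u v \<longleftrightarrow>
     orthonormal_basis u \<and> orthonormal_basis v \<and>
     (\<forall>j. (\<lambda>i. (cmod (cinner (f i) (u j)))\<^sup>2) summable_on UNIV) \<and>
     (\<forall>j. ((\<lambda>i. cinner (f i) (u j) *\<^sub>C v i) has_sum w j) UNIV)"

section \<open>The Hilbert space of square-integrable functions on the real line\<close>

definition square_integrable :: "(real \<Rightarrow> complex) \<Rightarrow> bool" where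
  "square_integrable f \<longleftrightarrow>
     f \<in> borel_measurable lborel \<and> integrable lborel (\<lambda>t. (cmod (f t))\<^sup>2)"

lemma square_integrable_zero: "square_integrable (\<lambda>_. 0)"
  by (simp add: square_integrable_def)

lemma square_integrable_cmult:
  assumes "square_integrable f"
  shows "square_integrable (\<lambda>t. c * f t)"
  using assms by (auto simp: square_integrable_def norm_mult power_mult_distrib)

lemma square_integrable_add:
  assumes "square_integrable f" "square_integrable g"
  shows "square_integrable (\<lambda>t. f t + g t)"
proof -
  have meas [measurable]: "f \<in> borel_measurable borel" "g \<in> borel_measurable borel"
    using assms by (simp_all add: square_integrable_def)
  have int: "integrable lborel (\<lambda>t. 2 * (cmod (f t))\<^sup>2 + 2 * (cmod (g t))\<^sup>2)"
    using assms by (simp add: square_integrable_def)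
  have le: "(cmod (f t + g t))\<^sup>2 \<le> 2 * (cmod (f t))\<^sup>2 + 2 * (cmod (g t))\<^sup>2" for t
  proof -
    have "(cmod (f t + g t))\<^sup>2 \<le> (cmod (f t) + cmod (g t))\<^sup>2"
      by (intro power_mono norm_triangle_ineq) auto
    also have "\<dots> \<le> 2 * (cmod (f t))\<^sup>2 + 2 * (cmod (g t))\<^sup>2"
      using sum_squares_bound[of "cmod (f t)" "cmod (g t)"] by (simp add: power2_sum)
    finally show ?thesis .
  qed
  have "integrable lborel (\<lambda>t. (cmod (f t + g t))\<^sup>2)"
  proof (rule Bochner_Integration.integrable_bound[OF int])
    show "AE t in lborel. norm ((cmod (f t + g t))\<^sup>2) \<le> norm (2 * (cmod (f t))\<^sup>2 + 2 * (cmod (g t))\<^sup>2)"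
      using order.trans[OF le abs_ge_self] by (intro AE_I2) simp
  qed simp
  with meas show ?thesis
    by (simp add: square_integrable_def)
qed

lemma square_integrable_uminus: "square_integrable f \<Longrightarrow> square_integrable (\<lambda>t. - f t)"
  by (auto simp: square_integrable_def)

lemma square_integrable_diff:
  assumes "square_integrable f" "square_integrable g"
  shows "square_integrable (\<lambda>t. f t - g t)"
  using square_integrable_add[OF assms(1) square_integrable_uminus[OF assms(2)]] by simp

lemma square_integrable_imp_integrable:
  assumes "square_integrable f" "square_integrable g"
  shows "integrable lborel (\<lambda>t. f t * cnj (g t))"
proof -
  have [measurable]: "f \<in> borel_measurable borel" "g \<in> borel_measurable borel"
    using assms by (simp_all add: square_integrable_def)
  have int: "integrable lborel (\<lambda>t. (cmod (f t))\<^sup>2 + (cmod (g t))\<^sup>2)"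
    using assms by (simp add: square_integrable_def)
  have [measurable]: "(\<lambda>t. cnj (g t)) \<in> borel_measurable borel"
    by (rule borel_measurable_continuous_on[OF continuous_on_cnj[OF continuous_on_id]]) simp
  have le: "cmod (f t) * cmod (g t) \<le> (cmod (f t))\<^sup>2 + (cmod (g t))\<^sup>2" for t
    using sum_squares_bound[of "cmod (f t)" "cmod (g t)"]
      mult_nonneg_nonneg[OF norm_ge_zero[of "f t"] norm_ge_zero[of "g t"]] by linarith
  show ?thesis
  proof (rule Bochner_Integration.integrable_bound[OF int])
    show "AE t in lborel. norm (f t * cnj (g t)) \<le> norm ((cmod (f t))\<^sup>2 + (cmod (g t))\<^sup>2)"
      using order.trans[OF le abs_ge_self] by (intro AE_I2) (simp add: norm_mult)
  qed simp
qed

lemma square_integrable_translate: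
  assumes "square_integrable f"
  shows "square_integrable (\<lambda>t. f (t - x))"
proof -
  have [measurable]: "f \<in> borel_measurable borel"
    and "integrable lborel (\<lambda>t. (cmod (f t))\<^sup>2)"
    using assms by (auto simp: square_integrable_def)
  with lborel_integrable_real_affine[OF this(2), of 1 "- x"] show ?thesis
    by (simp add: square_integrable_def)
qed

lemma square_integrable_modulate:
  assumes "square_integrable f"
  shows "square_integrable (\<lambda>t. cis (2 * pi * x * t) * f t)"
proof -
  have "(\<lambda>t. cis (2 * pi * x * t)) \<in> borel_measurable borel"
    by (intro borel_measurable_continuous_onI continuous_intros)
  with assms show ?thesis
    by (auto simp: square_integrable_def norm_mult)
qed

text \<open>Elements are classes of Borel functions modulo equality almost everywhere; since every
  Lebesgue measurable function is almost everywhere equal to a Borel one, this is the usual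
  space.\<close>

quotient_type L2R = "real \<Rightarrow> complex" / partial:
  "\<lambda>f g. square_integrable f \<and> square_integrable g \<and> (AE t in lborel. f t = g t)"
  by (rule part_equivpI) (auto intro!: exI[of _ "\<lambda>_. 0"] sympI transpI square_integrable_zero)

instantiation L2R :: ab_group_add
begin

lift_definition zero_L2R :: L2R is "\<lambda>_. 0"
  by (simp add: square_integrable_zero)

lift_definition plus_L2R :: "L2R \<Rightarrow> L2R \<Rightarrow> L2R" is "\<lambda>f g t. f t + g t"
  by (auto intro: square_integrable_add)

lift_definition minus_L2R :: "L2R \<Rightarrow> L2R \<Rightarrow> L2R" is "\<lambda>f g t. f t - g t"
  by (auto intro: square_integrable_diff)

lift_definition uminus_L2R :: "L2R \<Rightarrow> L2R" is "\<lambda>f t. - f t"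
  by (auto intro: square_integrable_uminus)

instance
  by standard
    (transfer; auto intro!: square_integrable_add square_integrable_diff square_integrable_uminus
      square_integrable_zero simp: algebra_simps)+

end

instantiation L2R :: complex_inner
begin

lift_definition scaleC_L2R :: "complex \<Rightarrow> L2R \<Rightarrow> L2R" is "\<lambda>c f t. c * f t"
  by (auto intro: square_integrable_cmult)

lift_definition cinner_L2R :: "L2R \<Rightarrow> L2R \<Rightarrow> complex" is "\<lambda>f g. LINT t|lborel. f t * cnj (g t)"
proof -
  fix f g f' g' :: "real \<Rightarrow> complex"
  assume 1: "square_integrable f \<and> square_integrable g \<and> (AE t in lborel. f t = g t)"
    and 2: "square_integrable f' \<and> square_integrable g' \<and> (AE t in lborel. f' t = g' t)"
  then have "AE t in lborel. f t * cnj (f' t) = g t * cnj (g' t)" by auto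
  with 1 2 square_integrable_imp_integrable
  show "(LINT t|lborel. f t * cnj (f' t)) = (LINT t|lborel. g t * cnj (g' t))"
    by (intro integral_cong_AE) (auto intro: borel_measurable_integrable)
qed

definition scaleR_L2R :: "real \<Rightarrow> L2R \<Rightarrow> L2R" where
  "scaleR_L2R r x = complex_of_real r *\<^sub>C x"

definition inner_L2R :: "L2R \<Rightarrow> L2R \<Rightarrow> real" where
  "inner_L2R x y = Re (cinner x y)"

definition norm_L2R :: "L2R \<Rightarrow> real" where
  "norm_L2R x = sqrt (inner x x)"

definition sgn_L2R :: "L2R \<Rightarrow> L2R" where
  "sgn_L2R x = inverse (norm x) *\<^sub>R x"

definition dist_L2R :: "L2R \<Rightarrow> L2R \<Rightarrow> real" where
  "dist_L2R x y = norm (x - y)"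

definition uniformity_L2R :: "(L2R \<times> L2R) filter" where
  "uniformity_L2R = (INF e\<in>{0<..}. principal {(x, y). dist x y < e})"

definition open_L2R :: "L2R set \<Rightarrow> bool" where
  "open_L2R U \<longleftrightarrow> (\<forall>x\<in>U. eventually (\<lambda>(x', y). x' = x \<longrightarrow> y \<in> U) uniformity)"

instance
proof
  fix x y z :: L2R and c d :: complex and r s :: real
  show addr: "c *\<^sub>C (x + y) = c *\<^sub>C x + c *\<^sub>C y" for c
    by transfer (auto intro!: square_integrable_add square_integrable_cmult simp: ring_distribs mult.assoc)
  show addl: "(c + d) *\<^sub>C x = c *\<^sub>C x + d *\<^sub>C x" for c d
    by transfer (auto intro!: square_integrable_add square_integrable_cmult simp: ring_distribs mult.assoc)
  show assoc: "c *\<^sub>C (d *\<^sub>C x) = (c * d) *\<^sub>C x" for c d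
    by transfer (auto intro!: square_integrable_cmult simp: ring_distribs mult.assoc)
  have one: "1 *\<^sub>C x = x"
    by transfer auto
  show "r *\<^sub>R x = complex_of_real r *\<^sub>C x" by (rule scaleR_L2R_def)
  show com: "cinner x y = cnj (cinner y x)" for x y :: L2R
    by transfer (auto simp flip: Bochner_Integration.integral_cnj simp: mult.commute)
  show add: "cinner (x + y) z = cinner x z + cinner y z" for x y z :: L2R
    by transfer (auto simp: ring_distribs square_integrable_imp_integrable)
  show scale: "cinner (c *\<^sub>C x) y = c * cinner x y" for c and x y :: L2R
    by transfer (auto simp: mult.assoc)
  show "inner x y = Re (cinner x y)" by (rule inner_L2R_def)
  show "r *\<^sub>R (x + y) = r *\<^sub>R x + r *\<^sub>R y"
    by (simp add: scaleR_L2R_def addr)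
  show "(r + s) *\<^sub>R x = r *\<^sub>R x + s *\<^sub>R x"
    by (simp add: scaleR_L2R_def addl)
  show "r *\<^sub>R s *\<^sub>R x = (r * s) *\<^sub>R x"
    by (simp add: scaleR_L2R_def assoc)
  show "1 *\<^sub>R x = x"
    by (simp add: scaleR_L2R_def one)
  show "inner x y = inner y x"
    unfolding inner_L2R_def by (subst com) simp
  show "inner (x + y) z = inner x z + inner y z"
    by (simp add: inner_L2R_def add)
  show "inner (r *\<^sub>R x) y = r * inner x y"
    by (simp add: inner_L2R_def scaleR_L2R_def scale)
  have sq: "Re (LINT t|lborel. f t * cnj (f t)) = (LINT t|lborel. (cmod (f t))\<^sup>2)" for f :: "real \<Rightarrow> complex"
    by (simp flip: complex_norm_square of_real_power)
  show "0 \<le> inner x x"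
    unfolding inner_L2R_def by transfer (simp add: sq)
  show "inner x x = 0 \<longleftrightarrow> x = 0"
    unfolding inner_L2R_def
    by transfer (auto simp: sq square_integrable_zero square_integrable_def integral_nonneg_eq_0_iff_AE)
  show "norm x = sqrt (inner x x)" by (rule norm_L2R_def)
  show "dist x y = norm (x - y)" by (rule dist_L2R_def)
  show "sgn x = inverse (norm x) *\<^sub>R x" by (rule sgn_L2R_def)
  show "uniformity = (INF e\<in>{0<..}. principal {(x, y::L2R). dist x y < e})" by (rule uniformity_L2R_def)
  show "open U \<longleftrightarrow> (\<forall>x\<in>U. eventually (\<lambda>(x', y). x' = x \<longrightarrow> y \<in> U) uniformity)" for U :: "L2R set"
    by (rule open_L2R_def)
qed

end

lift_definition modulation :: "real \<Rightarrow> L2R \<Rightarrow> L2R" is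
  "\<lambda>x g t. cis (2 * pi * x * t) * g t"
  by (auto intro: square_integrable_modulate)

lift_definition translation :: "real \<Rightarrow> L2R \<Rightarrow> L2R" is
  "\<lambda>x g t. g (t - x)"
proof -
  fix x :: real and f g :: "real \<Rightarrow> complex"
  assume *: "square_integrable f \<and> square_integrable g \<and> (AE t in lborel. f t = g t)"
  then have [measurable]: "f \<in> borel_measurable borel" "g \<in> borel_measurable borel"
    by (auto simp: square_integrable_def)
  have "AE t in lborel. f (- x + 1 * t) = g (- x + 1 * t)"
    using * by (intro AE_borel_affine) auto
  with * show "square_integrable (\<lambda>t. f (t - x)) \<and> square_integrable (\<lambda>t. g (t - x)) \<and>
      (AE t in lborel. f (t - x) = g (t - x))"
    by (auto intro: square_integrable_translate)
qed

definition gabor :: "real \<Rightarrow> real \<Rightarrow> L2R \<Rightarrow> int \<times> int \<Rightarrow> L2R" where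
  "gabor a b f = (\<lambda>(m, n). modulation (of_int m * b) (translation (of_int n * a) f))"

definition adjoint_gabor :: "real \<Rightarrow> real \<Rightarrow> L2R \<Rightarrow> int \<times> int \<Rightarrow> L2R" where
  "adjoint_gabor a b f =
     (\<lambda>(m, n). (1 / sqrt (a * b)) *\<^sub>R modulation (of_int m / a) (translation (of_int n / b) f))"

subsection \<open>Completeness\<close>

lemma square_integrable_rep_L2R: "square_integrable (rep_L2R x)"
  using Quotient3_rep_reflp[OF Quotient3_L2R, of x] by simp

lemma abs_L2R_rep_L2R_diff: "abs_L2R (\<lambda>t. rep_L2R x t - rep_L2R y t) = x - y"
  by (simp add: minus_L2R_def)

lemma norm_abs_L2R:
  assumes "square_integrable f"
  shows "ennreal ((norm (abs_L2R f))\<^sup>2) = (\<integral>\<^sup>+t. ennreal ((cmod (f t))\<^sup>2) \<partial>lborel)"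
proof -
  have "(norm (abs_L2R f))\<^sup>2 = Re (cinner (abs_L2R f) (abs_L2R f))"
    by (simp add: power2_norm_eq_inner inner_eq_Re_cinner)
  also have "\<dots> = (LINT t|lborel. (cmod (f t))\<^sup>2)"
    using assms by (simp add: cinner_L2R.abs_eq flip: complex_norm_square of_real_power)
  finally show ?thesis
    using assms by (subst nn_integral_eq_integral) (auto simp: square_integrable_def)
qed

lemma norm_L2R_diff:
  "ennreal ((norm (x - y))\<^sup>2) = (\<integral>\<^sup>+t. ennreal ((cmod (rep_L2R x t - rep_L2R y t))\<^sup>2) \<partial>lborel)"
  using norm_abs_L2R[OF square_integrable_diff[OF square_integrable_rep_L2R square_integrable_rep_L2R]]
  by (simp add: abs_L2R_rep_L2R_diff)

instance L2R :: chilbert_space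
proof
  fix X :: "nat \<Rightarrow> L2R"
  assume X: "Cauchy X"
  define R where "R n = rep_L2R (X n)" for n
  have R: "square_integrable (R n)" for n
    by (simp add: R_def square_integrable_rep_L2R)
  then have [measurable]: "R n \<in> borel_measurable borel" for n
    by (simp add: square_integrable_def)
  have norm_X: "ennreal ((norm (X m - X n))\<^sup>2) = (\<integral>\<^sup>+t. ennreal ((cmod (R m t - R n t))\<^sup>2) \<partial>lborel)" for m n
    by (simp add: R_def norm_L2R_diff)
  have "\<exists>N. \<forall>m\<ge>N. \<forall>n\<ge>N. norm (X m - X n) < (1 / 4) ^ k" for k
    using CauchyD[OF X, of "(1 / 4) ^ k"] by simp
  then obtain N where N: "norm (X m - X n) < (1 / 4) ^ k" if "m \<ge> N k" "n \<ge> N k" for k m n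
    by metis
  define r where "r k = Max (N ` {..k}) + k" for k
  have N_le_r: "N k \<le> r k" for k
    by (simp add: r_def trans_le_add1)
  have r_Suc: "r k \<le> r (Suc k)" for k
    unfolding r_def by (intro add_mono Max_mono) auto
  have r_ge: "k \<le> r k" for k
    by (simp add: r_def)
  define G where "G k t = (cmod (R (r (Suc k)) t - R (r k) t))\<^sup>2" for k t
  have [measurable]: "G k \<in> borel_measurable borel" for k
    unfolding G_def by measurable
  have "(\<integral>\<^sup>+t. (\<Sum>k. ennreal (4 ^ k * G k t)) \<partial>lborel) = (\<Sum>k. \<integral>\<^sup>+t. ennreal (4 ^ k * G k t) \<partial>lborel)"
    by (intro nn_integral_suminf) auto
  also have "\<dots> \<le> (\<Sum>k. ennreal ((1 / 4) ^ k))"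
  proof (intro suminf_le)
    fix k
    have "(\<integral>\<^sup>+t. ennreal (4 ^ k * G k t) \<partial>lborel) = ennreal (4 ^ k * (norm (X (r (Suc k)) - X (r k)))\<^sup>2)"
      by (simp add: ennreal_mult nn_integral_cmult norm_X G_def)
    also have "\<dots> \<le> ennreal (4 ^ k * ((1 / 4) ^ k)\<^sup>2)"
      using N[OF order.trans[OF N_le_r r_Suc] N_le_r, of k]
      by (intro ennreal_leI mult_left_mono power_mono) auto
    also have "4 ^ k * ((1 / 4) ^ k)\<^sup>2 = (1 / 4 :: real) ^ k"
      by (simp add: power2_eq_square flip: power_mult_distrib)
    finally show "(\<integral>\<^sup>+t. ennreal (4 ^ k * G k t) \<partial>lborel) \<le> ennreal ((1 / 4) ^ k)" .
  qed auto
  also have "\<dots> < \<infinity>"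
  proof -
    have "summable (\<lambda>k. (1 / 4 :: real) ^ k)"
      by (rule summable_geometric) simp
    then have "(\<Sum>k. ennreal ((1 / 4) ^ k)) \<noteq> top"
      by (rule ennreal_suminf_neq_top) (rule zero_le_power, simp)
    then show ?thesis
      by (simp only: infinity_ennreal_def less_top)
  qed
  finally have "AE t in lborel. (\<Sum>k. ennreal (4 ^ k * G k t)) \<noteq> \<infinity>"
    by (intro nn_integral_PInf_AE) simp_all
  then have conv: "AE t in lborel. convergent (\<lambda>k. R (r k) t)"
  proof eventually_elim
    case (elim t)
    then have "summable (\<lambda>k. 4 ^ k * G k t)"
      by (intro summable_suminf_not_top) (auto simp: G_def)
    then have C: "4 ^ k * G k t \<le> (\<Sum>k. 4 ^ k * G k t)" (is "_ \<le> ?C") for k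
      using sum_le_suminf[of "\<lambda>k. 4 ^ k * G k t" "{k}"] by (simp add: G_def)
    have "norm (R (r (Suc k)) t - R (r k) t) \<le> sqrt ?C * (1 / 2) ^ k" for k
    proof -
      have "(4 :: real) ^ k = (2 ^ k)\<^sup>2"
        by (simp add: power2_eq_square flip: power_mult_distrib)
      then have "(2 ^ k * cmod (R (r (Suc k)) t - R (r k) t))\<^sup>2 \<le> ?C"
        using C[of k] by (simp only: G_def power_mult_distrib)
      then have "2 ^ k * cmod (R (r (Suc k)) t - R (r k) t) \<le> sqrt ?C"
        by (rule real_le_rsqrt)
      then show ?thesis
        by (simp add: field_simps)
    qed
    then have "summable (\<lambda>k. R (r (Suc k)) t - R (r k) t)"
      by (intro summable_comparison_test'[OF summable_mult[OF summable_geometric]]) auto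
    then have "convergent (\<lambda>n. \<Sum>k<n. R (r (Suc k)) t - R (r k) t)"
      by (simp add: summable_iff_convergent)
    then have "convergent (\<lambda>n. (R (r n) t - R (r 0) t) + R (r 0) t)"
      by (intro convergent_add convergent_const) (simp add: sum_lessThan_telescope[where f="\<lambda>k. R (r k) t"])
    then show ?case
      by simp
  qed
  define g where "g t = lim (\<lambda>k. R (r k) t)" for t
  have [measurable]: "g \<in> borel_measurable borel"
    unfolding g_def by measurable
  have close: "(\<integral>\<^sup>+t. ennreal ((cmod (g t - R n t))\<^sup>2) \<partial>lborel) \<le> ennreal (e\<^sup>2)"
    if "\<forall>m\<ge>M. norm (X m - X n) \<le> e" for n M e
  proof -
    have "(\<integral>\<^sup>+t. ennreal ((cmod (g t - R n t))\<^sup>2) \<partial>lborel) =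
        (\<integral>\<^sup>+t. liminf (\<lambda>k. ennreal ((cmod (R (r k) t - R n t))\<^sup>2)) \<partial>lborel)"
    proof (intro nn_integral_cong_AE, use conv in eventually_elim)
      case (elim t)
      then have "(\<lambda>k. R (r k) t) \<longlonglongrightarrow> g t"
        by (simp add: g_def convergent_LIMSEQ_iff)
      then have "(\<lambda>k. ennreal ((cmod (R (r k) t - R n t))\<^sup>2)) \<longlonglongrightarrow> ennreal ((cmod (g t - R n t))\<^sup>2)"
        by (intro tendsto_intros) auto
      then show ?case
        by (intro lim_imp_Liminf[symmetric]) auto
    qed
    also have "\<dots> \<le> liminf (\<lambda>k. \<integral>\<^sup>+t. ennreal ((cmod (R (r k) t - R n t))\<^sup>2) \<partial>lborel)"
      by (intro nn_integral_liminf) auto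
    also have "\<dots> = liminf (\<lambda>k. ennreal ((norm (X (r k) - X n))\<^sup>2))"
      by (simp add: norm_X)
    also have "\<dots> \<le> ennreal (e\<^sup>2)"
    proof (rule Liminf_le)
      show "\<forall>\<^sub>F k in sequentially. ennreal ((norm (X (r k) - X n))\<^sup>2) \<le> ennreal (e\<^sup>2)"
        using eventually_ge_at_top[of M]
      proof eventually_elim
        case (elim k)
        then show ?case
          using that r_ge[of k] by (intro ennreal_leI power_mono) auto
      qed
    qed auto
    finally show ?thesis .
  qed
  have sq_diff: "square_integrable (\<lambda>t. g t - R n t)" if "\<forall>m\<ge>M. norm (X m - X n) \<le> e" for n M e
    unfolding square_integrable_def
    using close[OF that] by (auto intro!: integrableI_bounded intro: le_less_trans)
  obtain M where "\<forall>m\<ge>M. \<forall>n\<ge>M. norm (X m - X n) < 1"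
    using CauchyD[OF X, of 1] by auto
  then have "square_integrable (\<lambda>t. g t - R M t)"
    by (intro sq_diff[of M _ 1]) (auto intro: less_imp_le)
  from square_integrable_add[OF this R[of M]] have g: "square_integrable g"
    by simp
  have "X \<longlonglongrightarrow> abs_L2R g"
  proof (rule LIMSEQ_I)
    fix e :: real
    assume "0 < e"
    then obtain M where M: "\<forall>m\<ge>M. \<forall>n\<ge>M. norm (X m - X n) < e / 2"
      using CauchyD[OF X, of "e / 2"] by auto
    have "norm (X n - abs_L2R g) < e" if "n \<ge> M" for n
    proof -
      have eq: "abs_L2R g - X n = abs_L2R (\<lambda>t. g t - R n t)"
        using minus_L2R.abs_eq[of g "R n"] g R[of n]
        by (simp add: R_def Quotient3_abs_rep[OF Quotient3_L2R])
      have "ennreal ((norm (abs_L2R g - X n))\<^sup>2) \<le> ennreal ((e / 2)\<^sup>2)"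
        unfolding eq norm_abs_L2R[OF square_integrable_diff[OF g R]]
        using M that by (intro close[of M]) (auto intro: less_imp_le)
      then have "norm (abs_L2R g - X n) \<le> e / 2"
        using \<open>0 < e\<close> by (simp add: ennreal_le_iff power2_le_iff_abs_le)
      then show ?thesis
        using \<open>0 < e\<close> by (simp add: norm_minus_commute)
    qed
    then show "\<exists>M. \<forall>n\<ge>M. norm (X n - abs_L2R g) < e"
      by blast
  qed
  then show "convergent X"
    by (rule convergentI)
qed

end

(* A Gabor system that is a Riesz basis has critical density: a * b = 1. Indeed, its biorthogonal
   system is again a Gabor system, with a window g. Expanding the indicator of an interval J with
   |J| <= 1/b, and summing over the modulations with Parseval's identity for Fourier series of
   period 1/b, gives  b |J| = sum_n int_J f(t - n a) conj(g(t - n a)) dt.  Adding up over a partition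
   of [0, a) yields  a b = <f, g> = 1.

   For a * b = 1 the adjoint system is the system itself, and the time-frequency shifts commute.
   With the orthonormal basis e_i generated by a normalized indicator function e,
   <f_i, e_{-j}> = <f_{i+j}, e> is symmetric in i and j, so that u = v = (e_{-i}) exhibits the system
   as its own R-dual.

   Conversely, let u, v be Parseval frames realizing a Riesz basis w as a weak R-dual of a Riesz
   basis f. The coefficients delta_ik - <v_k, v_i> synthesize from f a vector orthogonal to all u_j,
   hence 0, so they vanish and v is orthonormal. Since <w_j, v_i> = <f_i, u_j>, the same argument
   with the roles of (f, v) and (w, u) exchanged applies to u. *)

theory Submission
  imports Defs
begin

section \<open>Complex inner products and orthogonal decomposition\<close>

lemma cinner_zero_left [simp]: "cinner 0 x = 0"
  using cinner_add_left[of 0 0 x] by simp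

lemma cinner_zero_right [simp]: "cinner x 0 = 0"
  by (subst cinner_commute) simp

lemma cinner_add_right: "cinner x (y + z) = cinner x y + cinner x z"
  by (subst (1 2 3) cinner_commute) (simp add: cinner_add_left)

lemma cinner_scaleC_right: "cinner x (c *\<^sub>C y) = cnj c * cinner x y"
  by (subst (1 2) cinner_commute) (simp add: cinner_scaleC_left)

lemma cinner_minus_left: "cinner (- x) y = - cinner x y"
  using cinner_add_left[of x "- x" y] by (simp add: add_eq_0_iff)

lemma cinner_diff_left: "cinner (x - y) z = cinner x z - cinner y z"
  using cinner_add_left[of x "- y" z] by (simp add: cinner_minus_left)

lemma cinner_sum_left: "cinner (\<Sum>i\<in>F. x i) y = (\<Sum>i\<in>F. cinner (x i) y)"
  by (induction F rule: infinite_finite_induct) (simp_all add: cinner_add_left)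

lemma cinner_self: "cinner x x = complex_of_real ((norm x)\<^sup>2)"
proof (rule complex_eqI)
  show "Im (cinner x x) = Im (complex_of_real ((norm x)\<^sup>2))"
    using arg_cong[OF cinner_commute[of x x], of Im] by simp
qed (simp add: power2_norm_eq_inner inner_eq_Re_cinner)

lemma cinner_eq_zero_commute: "cinner x y = 0 \<longleftrightarrow> cinner y x = 0"
  by (subst cinner_commute) simp

lemma norm_scaleC: "norm (c *\<^sub>C x) = cmod c * norm (x :: 'a::complex_inner)"
proof (rule power2_eq_imp_eq)
  have "cinner (c *\<^sub>C x) (c *\<^sub>C x) = complex_of_real ((cmod c)\<^sup>2) * cinner x x"
    unfolding cinner_scaleC_left cinner_scaleC_right complex_norm_square by (simp only: mult_ac)
  then show "(norm (c *\<^sub>C x))\<^sup>2 = (cmod c * norm x)\<^sup>2"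
    unfolding cinner_self of_real_mult[symmetric] of_real_eq_iff power_mult_distrib .
qed auto

text \<open>Multiplying \<open>x\<close> by a unimodular scalar turns \<open>cinner x y\<close> into
  its modulus, which is then a real inner product, so the real Cauchy-Schwarz inequality
  applies.\<close>

lemma cmod_cinner_le: "cmod (cinner x y) \<le> norm x * norm y"
proof (cases "cinner x y = 0")
  case False
  define c where "c = cnj (sgn (cinner x y))"
  have "c * cinner x y = complex_of_real (cmod (cinner x y))"
    using False by (simp add: c_def sgn_eq field_simps complex_norm_square[symmetric] power2_eq_square
        flip: of_real_mult)
  then have "cmod (cinner x y) = inner (c *\<^sub>C x) y"
    by (simp add: inner_eq_Re_cinner cinner_scaleC_left)
  also have "\<dots> \<le> norm (c *\<^sub>C x) * norm y"
    by (rule norm_cauchy_schwarz)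
  also have "\<dots> = norm x * norm y"
    using False by (simp add: norm_scaleC c_def norm_sgn)
  finally show ?thesis .
qed simp

lemma bounded_linear_cinner_left: "bounded_linear (\<lambda>x. cinner x y)"
  by (rule bounded_linear_intro[where K = "norm y"])
    (simp_all add: cinner_add_left scaleR_scaleC cinner_scaleC_left scaleR_conv_of_real cmod_cinner_le)

lemmas continuous_on_cinner_left [continuous_intros] =
  bounded_linear.continuous_on[OF bounded_linear_cinner_left]

lemma norm_add_scaleC_square:
  "(norm (x + c *\<^sub>C y))\<^sup>2 = (norm x)\<^sup>2 + 2 * Re (cnj c * cinner x y) + (cmod c)\<^sup>2 * (norm y)\<^sup>2"
proof -
  have "Re (c * cinner y x) = Re (cnj c * cinner x y)"
    by (subst cinner_commute) simp
  moreover have "Re (cinner (c *\<^sub>C y) (c *\<^sub>C y)) = (cmod c)\<^sup>2 * (norm y)\<^sup>2"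
    by (simp add: cinner_self norm_scaleC power_mult_distrib)
  ultimately show ?thesis
    by (simp add: power2_norm_eq_inner[of "x + _"] inner_eq_Re_cinner cinner_add_left cinner_add_right)
       (simp add: cinner_self cinner_scaleC_left cinner_scaleC_right)
qed

lemma norm_sum_orthonormal:
  assumes "\<And>i j. cinner (e i) (e j) = (if i = j then 1 else 0)" "finite F"
  shows "(norm (\<Sum>i\<in>F. c i *\<^sub>C e i))\<^sup>2 = (\<Sum>i\<in>F. (cmod (c i))\<^sup>2)"
  using assms(2)
proof (induction F)
  case (insert k F)
  have "cinner (\<Sum>i\<in>F. c i *\<^sub>C e i) (e k) = 0"
    using insert.hyps by (auto simp: cinner_sum_left cinner_scaleC_left assms(1) intro!: sum.neutral)
  moreover have "norm (e k) = 1"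
    using cinner_self[of "e k"] assms(1)[of k k] norm_ge_zero[of "e k"]
    by (auto simp: power2_eq_1_iff simp del: of_real_power)
  ultimately show ?case
    using insert norm_add_scaleC_square[of "\<Sum>i\<in>F. c i *\<^sub>C e i" "c k" "e k"]
    by (simp add: add.commute)
qed simp

text \<open>Projection theorem for a subspace that need not be closed: a minimizing sequence in
  \<open>M\<close> for the distance to \<open>x\<close> is Cauchy, its limit \<open>l\<close> lies
  in the closure, and minimality makes \<open>h = x - l\<close> orthogonal to
  \<open>M\<close>.\<close>

lemma orthogonal_decomposition:
  fixes x :: "'a::chilbert_space"
  assumes M: "complex_vector.subspace M"
  shows "\<exists>h. (\<forall>m\<in>M. cinner h m = 0) \<and> x - h \<in> closure M"
proof -
  have M0: "0 \<in> M" and Madd: "m \<in> M \<Longrightarrow> m' \<in> M \<Longrightarrow> m + m' \<in> M"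
    and Mscale: "m \<in> M \<Longrightarrow> c *\<^sub>C m \<in> M" and Mdiff: "m \<in> M \<Longrightarrow> m' \<in> M \<Longrightarrow> m - m' \<in> M" for m m' c
    using M by (auto simp: complex_vector.subspace_def intro: complex_vector.subspace_diff)
  define D where "D = (\<lambda>m. (norm (x - m))\<^sup>2) ` M"
  define d where "d = Inf D"
  have bdd: "bdd_below D"
    unfolding D_def by (rule bdd_belowI2[where m=0]) simp
  have d_le: "d \<le> (norm (x - m))\<^sup>2" if "m \<in> M" for m
    unfolding d_def using bdd that by (intro cInf_lower) (auto simp: D_def)
  have "\<exists>m\<in>M. (norm (x - m))\<^sup>2 < d + 1 / real (Suc n)" for n
  proof -
    have "D \<noteq> {}" using M0 by (auto simp: D_def)
    then have "\<exists>y\<in>D. y < d + 1 / real (Suc n)"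
      using cInf_lessD[of D "d + 1 / real (Suc n)"] unfolding d_def by auto
    then show ?thesis by (auto simp: D_def)
  qed
  then obtain m where mM: "m n \<in> M" and m: "(norm (x - m n))\<^sup>2 < d + 1 / real (Suc n)" for n
    by metis
  \<comment> \<open>Parallelogram law for \<open>x - m p\<close> and \<open>x - m q\<close>: the
    midpoint of \<open>m p\<close> and \<open>m q\<close> lies in \<open>M\<close>, so its distance
    to \<open>x\<close> is bounded below by \<open>d\<close>.\<close>
  have close: "(norm (m p - m q))\<^sup>2 \<le> 2 / real (Suc p) + 2 / real (Suc q)" for p q
  proof -
    have "(1 / 2) *\<^sub>R (m p + m q) \<in> M"
      using mM Mscale Madd by (simp add: scaleR_scaleC)
    from d_le[OF this] have "4 * d \<le> (norm (2 *\<^sub>R (x - (1 / 2) *\<^sub>R (m p + m q))))\<^sup>2"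
      by (simp only: norm_scaleR power_mult_distrib) simp
    also have "2 *\<^sub>R (x - (1 / 2) *\<^sub>R (m p + m q)) = (x - m p) + (x - m q)"
      by (simp add: algebra_simps scaleR_2)
    finally have "4 * d \<le> (norm ((x - m p) + (x - m q)))\<^sup>2" .
    moreover have "(norm ((x - m p) + (x - m q)))\<^sup>2 + (norm ((x - m q) - (x - m p)))\<^sup>2
        = 2 * (norm (x - m p))\<^sup>2 + 2 * (norm (x - m q))\<^sup>2"
      by (simp add: power2_norm_eq_inner inner_add_left inner_add_right inner_diff_left inner_diff_right
          inner_commute)
    moreover have "(x - m q) - (x - m p) = m p - m q" by simp
    ultimately show ?thesis
      using m[of p] m[of q] by simp
  qed
  have "Cauchy m"
  proof (rule metric_CauchyI)
    fix e :: real assume "e > 0"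
    then have "e\<^sup>2 / 4 > 0" by simp
    from reals_Archimedean[OF this] obtain N where N: "inverse (real (Suc N)) < e\<^sup>2 / 4" by auto
    show "\<exists>N. \<forall>p\<ge>N. \<forall>q\<ge>N. dist (m p) (m q) < e"
    proof (intro exI allI impI)
      fix p q assume "N \<le> p" "N \<le> q"
      then have "1 / real (Suc p) \<le> inverse (real (Suc N))" "1 / real (Suc q) \<le> inverse (real (Suc N))"
        by (auto simp: divide_simps)
      with close[of p q] N have "(norm (m p - m q))\<^sup>2 < e\<^sup>2"
        by simp
      then show "dist (m p) (m q) < e"
        using \<open>e > 0\<close> by (auto simp: dist_norm intro: power2_less_imp_less)
    qed
  qed
  then obtain l where l: "m \<longlonglongrightarrow> l"
    by (auto simp: Cauchy_convergent_iff convergent_def)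
  then have l_cl: "l \<in> closure M"
    using mM by (auto simp: closure_sequential)
  define h where "h = x - l"
  have h_le: "(norm h)\<^sup>2 \<le> (norm (h + m'))\<^sup>2" if m': "m' \<in> M" for m'
  proof -
    have "(\<lambda>n. (norm (x - m n))\<^sup>2) \<longlonglongrightarrow> (norm h)\<^sup>2"
      unfolding h_def by (intro tendsto_intros l)
    moreover have "(\<lambda>n. d + 1 / real (Suc n)) \<longlonglongrightarrow> d + 0"
      using LIMSEQ_inverse_real_of_nat by (intro tendsto_intros) (simp add: inverse_eq_divide)
    ultimately have "(norm h)\<^sup>2 \<le> d + 0"
      by (rule LIMSEQ_le) (use m in \<open>auto intro!: exI[of _ 0] less_imp_le\<close>)
    moreover have "(\<lambda>n. (norm (x - (m n - m')))\<^sup>2) \<longlonglongrightarrow> (norm (x - (l - m')))\<^sup>2"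
      by (intro tendsto_intros l)
    then have "d \<le> (norm (x - (l - m')))\<^sup>2"
      by (rule LIMSEQ_le_const) (use d_le[OF Mdiff[OF mM m']] in auto)
    moreover have "x - (l - m') = h + m'"
      by (simp add: h_def)
    ultimately show ?thesis
      by (metis add_0_right order_trans)
  qed
  have "cinner h m' = 0" if m': "m' \<in> M" for m'
  proof (rule ccontr)
    assume ne: "cinner h m' \<noteq> 0"
    \<comment> \<open>Perturbing \<open>h\<close> by \<open>- t * cinner h m'\<close> times
      \<open>m'\<close> lowers the squared norm to first order. Since
      \<open>t * (norm m')^2 < 1\<close>, the quadratic term is less than half the linear gain,
      which contradicts minimality.\<close>
    define t where "t = 1 / (1 + (norm m')\<^sup>2)"
    have t: "t > 0" "t * (norm m')\<^sup>2 < 1"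
      by (auto simp: t_def divide_simps add_pos_nonneg)
    define c where "c = - complex_of_real t * cinner h m'"
    have "(norm h)\<^sup>2 \<le> (norm (h + c *\<^sub>C m'))\<^sup>2"
      by (intro h_le Mscale m')
    also have "\<dots> = (norm h)\<^sup>2 - 2 * t * (cmod (cinner h m'))\<^sup>2
        + t\<^sup>2 * (cmod (cinner h m'))\<^sup>2 * (norm m')\<^sup>2"
    proof -
      have "cnj c * cinner h m' = - complex_of_real (t * (cmod (cinner h m'))\<^sup>2)"
        unfolding of_real_mult complex_norm_square by (simp add: c_def mult_ac)
      moreover have "(cmod c)\<^sup>2 = t\<^sup>2 * (cmod (cinner h m'))\<^sup>2"
        by (simp add: c_def norm_mult power_mult_distrib)
      ultimately show ?thesis
        by (simp only: norm_add_scaleC_square) simp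
    qed
    finally have "2 * t * (cmod (cinner h m'))\<^sup>2 \<le> t * (cmod (cinner h m'))\<^sup>2 * (t * (norm m')\<^sup>2)"
      by (simp add: power2_eq_square mult_ac)
    also have "\<dots> \<le> t * (cmod (cinner h m'))\<^sup>2 * 1"
      using t by (intro mult_left_mono) auto
    finally show False
      using t ne by simp
  qed
  then show ?thesis
    using l_cl by (intro exI[of _ h]) (auto simp: h_def)
qed

section \<open>Riesz bases, biorthogonal systems and orthonormal expansions\<close>

text \<open>The upper Riesz bound controls a sum of vectors by the square sum of its coefficients,
  so the partial sums form a Cauchy filter and converge by completeness.\<close>

lemma summable_on_scaleC:
  fixes f :: "'i \<Rightarrow> 'a::chilbert_space"
  assumes upper: "\<And>F c. finite F \<Longrightarrow> (norm (\<Sum>i\<in>F. c i *\<^sub>C f i))\<^sup>2 \<le> B * (\<Sum>i\<in>F. (cmod (c i))\<^sup>2)"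
    and "B > 0" and c: "(\<lambda>i. (cmod (c i))\<^sup>2) summable_on UNIV"
  shows "(\<lambda>i. c i *\<^sub>C f i) summable_on UNIV"
proof -
  let ?\<F> = "finite_subsets_at_top (UNIV :: 'i set)"
  define S where "S F = (\<Sum>i\<in>F. (cmod (c i))\<^sup>2)" for F
  define s where "s = infsum (\<lambda>i. (cmod (c i))\<^sup>2) UNIV"
  have "(S \<longlongrightarrow> s) ?\<F>"
    using has_sum_infsum[OF c] by (simp add: has_sum_def S_def[abs_def] s_def)
  have S_le: "S F \<le> s" if "finite F" for F
    unfolding S_def s_def using that c by (intro finite_sum_le_infsum) auto
  have "cauchy_filter (filtermap (\<lambda>F. \<Sum>i\<in>F. c i *\<^sub>C f i) ?\<F>)"
    unfolding cauchy_filter_metric_filtermap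
  proof (intro allI impI)
    fix e :: real assume "e > 0"
    \<comment> \<open>Chosen so that \<open>B * d\<close> is the square of \<open>e / 2\<close>:
      partial sums over sets containing \<open>F0\<close> then differ from the one over
      \<open>F0\<close> by less than \<open>e / 2\<close>.\<close>
    define d where "d = e\<^sup>2 / (4 * B)"
    have "d > 0" using \<open>e > 0\<close> \<open>B > 0\<close> by (simp add: d_def)
    then have "\<forall>\<^sub>F F in ?\<F>. dist (S F) s < d"
      using \<open>(S \<longlongrightarrow> s) ?\<F>\<close> by (rule tendstoD[rotated])
    then obtain F0 where F0: "finite F0" "dist (S F0) s < d"
      by (auto simp: eventually_finite_subsets_at_top)
    have near: "norm ((\<Sum>i\<in>F. c i *\<^sub>C f i) - (\<Sum>i\<in>F0. c i *\<^sub>C f i)) < e / 2"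
      if F: "finite F" "F0 \<subseteq> F" for F
    proof -
      have "(norm (\<Sum>i\<in>F - F0. c i *\<^sub>C f i))\<^sup>2 \<le> B * S (F - F0)"
        unfolding S_def using F by (intro upper) auto
      also have "S (F - F0) = S F - S F0"
        unfolding S_def using F F0 by (simp add: sum_diff)
      also have "B * (S F - S F0) < B * d"
        using S_le[OF F(1)] F0(2) \<open>B > 0\<close> by (intro mult_strict_left_mono) (auto simp: dist_real_def)
      also have "B * d = (e / 2)\<^sup>2"
        using \<open>B > 0\<close> by (simp add: d_def power2_eq_square)
      finally have "norm (\<Sum>i\<in>F - F0. c i *\<^sub>C f i) < e / 2"
        by (rule power2_less_imp_less) (use \<open>e > 0\<close> in simp)
      then show ?thesis
        using F by (simp add: sum_diff)
    qed
    show "\<exists>P. eventually P ?\<F> \<and>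
        (\<forall>F G. P F \<and> P G \<longrightarrow> dist (\<Sum>i\<in>F. c i *\<^sub>C f i) (\<Sum>i\<in>G. c i *\<^sub>C f i) < e)"
    proof (intro exI[of _ "\<lambda>F. finite F \<and> F0 \<subseteq> F"] conjI allI impI)
      show "\<forall>\<^sub>F F in ?\<F>. finite F \<and> F0 \<subseteq> F"
        using F0(1) by (auto simp: eventually_finite_subsets_at_top)
      fix F G :: "'i set"
      assume FG: "(finite F \<and> F0 \<subseteq> F) \<and> (finite G \<and> F0 \<subseteq> G)"
      show "dist (\<Sum>i\<in>F. c i *\<^sub>C f i) (\<Sum>i\<in>G. c i *\<^sub>C f i) < e"
      proof (rule dist_triangle_half_l)
        show "dist (\<Sum>i\<in>F. c i *\<^sub>C f i) (\<Sum>i\<in>F0. c i *\<^sub>C f i) < e / 2"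
          "dist (\<Sum>i\<in>G. c i *\<^sub>C f i) (\<Sum>i\<in>F0. c i *\<^sub>C f i) < e / 2"
          unfolding dist_norm using FG near[of F] near[of G] by simp_all
      qed
    qed
  qed
  then have "\<exists>z. filtermap (\<lambda>F. \<Sum>i\<in>F. c i *\<^sub>C f i) ?\<F> \<le> nhds z"
    by (rule cauchy_filter_complete_converges[where A = "UNIV :: 'a set"])
      (auto simp: filtermap_bot_iff complete_UNIV)
  then obtain z where "filtermap (\<lambda>F. \<Sum>i\<in>F. c i *\<^sub>C f i) ?\<F> \<le> nhds z" ..
  then show ?thesis
    by (auto simp: summable_on_def has_sum_def filterlim_def)
qed

text \<open>The lower Riesz bound survives the limit along finite sets containing \<open>k\<close>.
  Consequently a series with sum 0 has only zero coefficients when \<open>A > 0\<close>.\<close>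

lemma coeff_le_norm_has_sum:
  assumes lower: "\<And>F c. finite F \<Longrightarrow> A * (\<Sum>i\<in>F. (cmod (c i))\<^sup>2) \<le> (norm (\<Sum>i\<in>F. c i *\<^sub>C f i))\<^sup>2"
    and "A \<ge> 0" and z: "((\<lambda>i. c i *\<^sub>C f i) has_sum z) UNIV"
  shows "A * (cmod (c k))\<^sup>2 \<le> (norm (z :: 'a::chilbert_space))\<^sup>2"
proof (rule tendsto_lowerbound)
  show "((\<lambda>F. (norm (\<Sum>i\<in>F. c i *\<^sub>C f i))\<^sup>2) \<longlongrightarrow> (norm z)\<^sup>2) (finite_subsets_at_top UNIV)"
    using z unfolding has_sum_def by (intro tendsto_intros)
  show "\<forall>\<^sub>F F in finite_subsets_at_top UNIV. A * (cmod (c k))\<^sup>2 \<le> (norm (\<Sum>i\<in>F. c i *\<^sub>C f i))\<^sup>2"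
    unfolding eventually_finite_subsets_at_top
  proof (intro exI[of _ "{k}"] conjI allI impI)
    fix F assume F: "finite F \<and> {k} \<subseteq> F \<and> F \<subseteq> UNIV"
    then have "(cmod (c k))\<^sup>2 \<le> (\<Sum>i\<in>F. (cmod (c i))\<^sup>2)"
      by (intro member_le_sum) auto
    then have "A * (cmod (c k))\<^sup>2 \<le> A * (\<Sum>i\<in>F. (cmod (c i))\<^sup>2)"
      using \<open>A \<ge> 0\<close> by (rule mult_left_mono)
    also have "\<dots> \<le> (norm (\<Sum>i\<in>F. c i *\<^sub>C f i))\<^sup>2"
      using F by (intro lower) auto
    finally show "A * (cmod (c k))\<^sup>2 \<le> (norm (\<Sum>i\<in>F. c i *\<^sub>C f i))\<^sup>2" .
  qed auto
qed auto

text \<open>Bessel's inequality by duality: testing the upper bound with the conjugates of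
  \<open>cinner (f i) x\<close> gives a vector \<open>z\<close> with \<open>cinner z x = ?S\<close>
  and squared norm at most \<open>B * ?S\<close>. Cauchy-Schwarz then allows one factor
  \<open>?S\<close> to be cancelled.\<close>

lemma sum_cinner_le:
  assumes upper: "\<And>c. (norm (\<Sum>i\<in>F. c i *\<^sub>C f i))\<^sup>2 \<le> B * (\<Sum>i\<in>F. (cmod (c i))\<^sup>2)"
    and "B \<ge> 0"
  shows "(\<Sum>i\<in>F. (cmod (cinner (f i) x))\<^sup>2) \<le> B * (norm x)\<^sup>2" (is "?S \<le> _")
proof -
  define c where "c i = cnj (cinner (f i) x)" for i
  define z where "z = (\<Sum>i\<in>F. c i *\<^sub>C f i)"
  have "cinner z x = complex_of_real ?S"
    unfolding of_real_sum complex_norm_square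
    by (simp add: z_def c_def cinner_sum_left cinner_scaleC_left mult.commute)
  then have "\<bar>?S\<bar> \<le> norm z * norm x"
    using cmod_cinner_le[of z x] by (simp only: norm_of_real)
  then have "?S\<^sup>2 \<le> (norm z * norm x)\<^sup>2"
    by (metis abs_ge_zero power2_abs power_mono)
  also have "\<dots> \<le> B * ?S * (norm x)\<^sup>2"
    using upper[of c] by (auto simp: z_def c_def power_mult_distrib intro: mult_right_mono)
  finally have le: "?S * ?S \<le> ?S * (B * (norm x)\<^sup>2)"
    by (simp add: power2_eq_square mult_ac)
  have "?S \<ge> 0" by (intro sum_nonneg) auto
  then show ?thesis
    using le \<open>B \<ge> 0\<close> by (cases "?S = 0") (simp_all add: mult_le_cancel_left)
qed

lemma summable_on_square_bounded:
  fixes x :: "'i \<Rightarrow> real"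
  assumes "\<And>F. finite F \<Longrightarrow> (\<Sum>i\<in>F. (x i)\<^sup>2) \<le> K"
  shows "(\<lambda>i. (x i)\<^sup>2) summable_on UNIV"
  using assms by (intro nonneg_bdd_above_summable_on) (auto simp: bdd_above_def)

section \<open>Biorthogonal systems: expansion and existence\<close>

lemma cspan_range_expansion:
  assumes g: "\<And>i j. cinner (f i) (g j) = (if i = j then 1 else 0)"
    and "x \<in> cspan (range f)"
  shows "\<exists>G. finite G \<and> (\<forall>i. i \<notin> G \<longrightarrow> cinner x (g i) = 0) \<and> x = (\<Sum>i\<in>G. cinner x (g i) *\<^sub>C f i)"
  using assms(2)
proof (induction x rule: complex_vector.span_induct_alt)
  case base
  then show ?case by (intro exI[of _ "{}"]) simp
next
  case (step c x y)
  then obtain k G where x: "x = f k" and G: "finite G" "\<And>i. i \<notin> G \<Longrightarrow> cinner y (g i) = 0"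
      "y = (\<Sum>i\<in>G. cinner y (g i) *\<^sub>C f i)"
    by auto
  have co: "cinner (c *\<^sub>C x + y) (g i) = (if i = k then c else 0) + cinner y (g i)" for i
    by (simp add: x cinner_add_left cinner_scaleC_left g)
  have "y = (\<Sum>i\<in>insert k G. cinner y (g i) *\<^sub>C f i)"
    using G by (subst G(3), intro sum.mono_neutral_left) auto
  moreover have "c *\<^sub>C x = (\<Sum>i\<in>insert k G. (if i = k then c else 0) *\<^sub>C f i)"
    using G(1) by (simp add: x if_distrib[of "\<lambda>c. c *\<^sub>C _"] cong: if_cong)
  ultimately have expand: "c *\<^sub>C x + y = (\<Sum>i\<in>insert k G. cinner (c *\<^sub>C x + y) (g i) *\<^sub>C f i)"
    unfolding co scaleC_add_left sum.distrib by (rule arg_cong2[where f="(+)", rotated])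
  then show ?case
  proof (intro exI[of _ "insert k G"] conjI allI impI)
    show "cinner (c *\<^sub>C x + y) (g i) = 0" if "i \<notin> insert k G" for i
      using that G(2) by (simp add: co)
  qed (use G(1) expand in simp_all)
qed

text \<open>The map sending \<open>x\<close> to the sum of the series is bounded and is the identity
  on the span of \<open>f\<close>; density makes it the identity everywhere.\<close>

lemma biorthogonal_expansion:
  fixes f g :: "'i \<Rightarrow> 'a::chilbert_space"
  assumes "riesz_basis f" and g: "\<And>i j. cinner (f i) (g j) = (if i = j then 1 else 0)"
  shows "((\<lambda>i. cinner x (g i) *\<^sub>C f i) has_sum x) UNIV"
proof -
  obtain A B where "0 < A" "A \<le> B" and dense: "closure (cspan (range f)) = UNIV"
    and lower: "\<And>F c. finite F \<Longrightarrow> A * (\<Sum>i\<in>F. (cmod (c i))\<^sup>2) \<le> (norm (\<Sum>i\<in>F. c i *\<^sub>C f i))\<^sup>2"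
    and upper: "\<And>F c. finite F \<Longrightarrow> (norm (\<Sum>i\<in>F. c i *\<^sub>C f i))\<^sup>2 \<le> B * (\<Sum>i\<in>F. (cmod (c i))\<^sup>2)"
    using assms(1) unfolding riesz_basis_def by blast
  have "B > 0" using \<open>0 < A\<close> \<open>A \<le> B\<close> by linarith
  \<comment> \<open>On the span this is the lower Riesz bound for the finite expansion of
    \<open>x\<close>. Both sides are continuous in \<open>x\<close>, so it extends to the
    closure.\<close>
  have bessel: "(\<Sum>i\<in>F. (cmod (cinner x (g i)))\<^sup>2) \<le> (norm x)\<^sup>2 / A" if F: "finite F" for F x
  proof -
    have span: "(\<Sum>i\<in>F. (cmod (cinner x (g i)))\<^sup>2) \<le> (norm x)\<^sup>2 / A" if "x \<in> cspan (range f)" for x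
    proof -
      from cspan_range_expansion[OF g that] obtain G where G: "finite G"
        "\<And>i. i \<notin> G \<Longrightarrow> cinner x (g i) = 0" "x = (\<Sum>i\<in>G. cinner x (g i) *\<^sub>C f i)"
        by blast
      have "A * (\<Sum>i\<in>F. (cmod (cinner x (g i)))\<^sup>2) \<le> A * (\<Sum>i\<in>F \<union> G. (cmod (cinner x (g i)))\<^sup>2)"
        using F G \<open>0 < A\<close> by (intro mult_left_mono sum_mono2) auto
      also have "(\<Sum>i\<in>F \<union> G. (cmod (cinner x (g i)))\<^sup>2) = (\<Sum>i\<in>G. (cmod (cinner x (g i)))\<^sup>2)"
        using F G by (intro sum.mono_neutral_right) auto
      also have "A * \<dots> \<le> (norm x)\<^sup>2"
        using lower[OF G(1), of "\<lambda>i. cinner x (g i)"] G(3) by simp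
      finally show ?thesis
        using \<open>0 < A\<close> by (simp add: field_simps)
    qed
    have "closed {x. (\<Sum>i\<in>F. (cmod (cinner x (g i)))\<^sup>2) \<le> (norm x)\<^sup>2 / A}"
      using \<open>0 < A\<close> by (intro closed_Collect_le continuous_intros) auto
    with span have "closure (cspan (range f)) \<subseteq> {x. (\<Sum>i\<in>F. (cmod (cinner x (g i)))\<^sup>2) \<le> (norm x)\<^sup>2 / A}"
      by (intro closure_minimal) auto
    then show ?thesis using dense by auto
  qed
  have summable: "(\<lambda>i. cinner x (g i) *\<^sub>C f i) summable_on UNIV" for x
    by (rule summable_on_scaleC[OF upper \<open>B > 0\<close>]) (auto intro: summable_on_square_bounded bessel)
  define z where "z x = infsum (\<lambda>i. cinner x (g i) *\<^sub>C f i) UNIV" for x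
  have z: "((\<lambda>i. cinner x (g i) *\<^sub>C f i) has_sum z x) UNIV" for x
    unfolding z_def using summable by (rule has_sum_infsum)
  have norm_z: "(norm (z x))\<^sup>2 \<le> B * ((norm x)\<^sup>2 / A)" for x
  proof (rule tendsto_upperbound)
    show "((\<lambda>F. (norm (\<Sum>i\<in>F. cinner x (g i) *\<^sub>C f i))\<^sup>2) \<longlongrightarrow> (norm (z x))\<^sup>2) (finite_subsets_at_top UNIV)"
      using z[of x] unfolding has_sum_def by (intro tendsto_intros)
    show "\<forall>\<^sub>F F in finite_subsets_at_top UNIV.
        (norm (\<Sum>i\<in>F. cinner x (g i) *\<^sub>C f i))\<^sup>2 \<le> B * ((norm x)\<^sup>2 / A)"
      using \<open>B > 0\<close>
      by (intro eventually_finite_subsets_at_top_weakI order.trans[OF upper] mult_left_mono bessel) auto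
  qed auto
  have z_span: "z y = y" if "y \<in> cspan (range f)" for y
  proof -
    from cspan_range_expansion[OF g that] obtain G where G: "finite G"
      "\<And>i. i \<notin> G \<Longrightarrow> cinner y (g i) = 0" "y = (\<Sum>i\<in>G. cinner y (g i) *\<^sub>C f i)"
      by blast
    have "((\<lambda>i. cinner y (g i) *\<^sub>C f i) has_sum y) UNIV"
      by (rule has_sum_finite_neutralI[where B = G]) (use G in auto)
    with z show ?thesis by (rule has_sum_unique)
  qed
  have z_diff: "z (x - y) = z x - z y" for x y
  proof (rule has_sum_unique[OF z])
    have "((\<lambda>i. cinner x (g i) *\<^sub>C f i + - (cinner y (g i) *\<^sub>C f i)) has_sum z x + - z y) UNIV"
      by (rule has_sum_add[OF z has_sum_bounded_linear[OF bounded_linear_minus[OF bounded_linear_ident] z]])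
    then show "((\<lambda>i. cinner (x - y) (g i) *\<^sub>C f i) has_sum z x - z y) UNIV"
      by (simp add: cinner_diff_left complex_vector.scale_left_diff_distrib)
  qed
  obtain y where y: "\<And>n. y n \<in> cspan (range f)" "y \<longlonglongrightarrow> x"
    using dense closure_sequential[of x "cspan (range f)"] by auto
  \<comment> \<open>\<open>z (x - y n)\<close> equals \<open>z x - y n\<close>. It tends to 0 by
    boundedness of \<open>z\<close>, and to \<open>z x - x\<close> because \<open>y n\<close> tends
    to \<open>x\<close>.\<close>
  have "(\<lambda>n. norm (z (x - y n))) \<longlonglongrightarrow> 0"
  proof (rule Lim_null_comparison)
    have "norm (z w) \<le> sqrt (B / A) * norm w" for w
    proof (rule power2_le_imp_le)
      show "(norm (z w))\<^sup>2 \<le> (sqrt (B / A) * norm w)\<^sup>2"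
        using norm_z[of w] \<open>0 < A\<close> \<open>0 < B\<close> by (simp add: power_mult_distrib)
    qed (use \<open>0 < A\<close> \<open>0 < B\<close> in auto)
    then show "\<forall>\<^sub>F n in sequentially. norm (norm (z (x - y n))) \<le> sqrt (B / A) * norm (x - y n)"
      by simp
    have "(\<lambda>n. sqrt (B / A) * norm (x - y n)) \<longlonglongrightarrow> sqrt (B / A) * norm (x - x)"
      by (intro tendsto_intros y)
    then show "(\<lambda>n. sqrt (B / A) * norm (x - y n)) \<longlonglongrightarrow> 0" by simp
  qed
  then have "(\<lambda>n. z x - y n) \<longlonglongrightarrow> 0"
    by (simp add: z_diff z_span y tendsto_norm_zero_iff)
  moreover have "(\<lambda>n. z x - y n) \<longlonglongrightarrow> z x - x"
    by (intro tendsto_intros y)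
  ultimately have "z x = x"
    using LIMSEQ_unique by fastforce
  with z[of x] show ?thesis by simp
qed

text \<open>The vector is the component \<open>h\<close> of \<open>f k\<close> orthogonal to all
  other \<open>f i\<close>, rescaled so that its product with \<open>f k\<close> is 1. It is nonzero
  because the lower Riesz bound keeps \<open>f k\<close> away from the span of the others.\<close>

lemma exists_biorthogonal:
  fixes f :: "'i \<Rightarrow> 'a::chilbert_space"
  assumes "riesz_basis f"
  shows "\<exists>g. \<forall>i. cinner (f i) g = (if i = k then 1 else 0)"
proof -
  obtain A where "0 < A"
    and lower: "\<And>F c. finite F \<Longrightarrow> A * (\<Sum>i\<in>F. (cmod (c i))\<^sup>2) \<le> (norm (\<Sum>i\<in>F. c i *\<^sub>C f i))\<^sup>2"
    using assms(1) unfolding riesz_basis_def by blast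
  define M where "M = cspan (f ` (- {k}))"
  obtain h where h: "\<And>m. m \<in> M \<Longrightarrow> cinner h m = 0" and cl: "f k - h \<in> closure M"
    using orthogonal_decomposition[of M "f k"] by (auto simp: M_def complex_vector.subspace_span)
  \<comment> \<open>The span is described by sums over vectors; choosing one index for each vector
    turns them into sums over indices, to which the Riesz bound applies.\<close>
  have expand: "\<exists>F c. finite F \<and> k \<notin> F \<and> m = (\<Sum>i\<in>F. c i *\<^sub>C f i)" if "m \<in> M" for m
  proof -
    from that obtain t r where t: "finite t" "t \<subseteq> f ` (- {k})" "m = (\<Sum>a\<in>t. r a *\<^sub>C a)"
      unfolding M_def complex_vector.span_explicit by auto
    from t(2) obtain F where F: "F \<subseteq> - {k}" "t = f ` F" "inj_on f F"
      by (auto simp: subset_image_inj)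
    show ?thesis
      using t F by (intro exI[of _ F] exI[of _ "\<lambda>i. r (f i)"])
        (auto simp: sum.reindex finite_image_iff)
  qed
  \<comment> \<open>The coefficient of \<open>f k\<close> in \<open>f k - m\<close> is 1, since
    \<open>k\<close> does not occur in the expansion of \<open>m\<close>.\<close>
  have far: "A \<le> (norm (f k - m))\<^sup>2" if "m \<in> M" for m
  proof -
    from expand[OF that] obtain F c where F: "finite F" "k \<notin> F" "m = (\<Sum>i\<in>F. c i *\<^sub>C f i)"
      by blast
    define c' where "c' = (\<lambda>i. if i = k then 1 else - c i)"
    have "f k - m = (\<Sum>i\<in>insert k F. c' i *\<^sub>C f i)"
    proof -
      have "(\<Sum>i\<in>F. c' i *\<^sub>C f i) = - m"
        unfolding F(3) sum_negf[symmetric]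
        using F(2) by (intro sum.cong) (auto simp: c'_def complex_vector.scale_minus_left)
      then show ?thesis using F by (simp add: c'_def)
    qed
    then have "A * (\<Sum>i\<in>insert k F. (cmod (c' i))\<^sup>2) \<le> (norm (f k - m))\<^sup>2"
      using lower[of "insert k F" c'] F(1) by simp
    moreover have "A * 1 \<le> A * (\<Sum>i\<in>insert k F. (cmod (c' i))\<^sup>2)"
      using F \<open>0 < A\<close> by (intro mult_left_mono) (auto simp: c'_def intro: sum_nonneg)
    ultimately show ?thesis by simp
  qed
  have "h \<noteq> 0"
  proof
    assume "h = 0"
    have "closure M \<subseteq> {m. A \<le> (norm (f k - m))\<^sup>2}"
      using far by (intro closure_minimal closed_Collect_le continuous_intros) auto
    with cl \<open>h = 0\<close> \<open>0 < A\<close> show False by auto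
  qed
  have "closure M \<subseteq> {m. cinner m h = 0}"
    using h by (intro closure_minimal closed_Collect_eq continuous_intros)
      (auto simp: cinner_eq_zero_commute[of h])
  with cl have "cinner (f k) h = cinner h h"
    by (auto simp: cinner_diff_left)
  moreover have "cinner (f i) h = 0" if "i \<noteq> k" for i
  proof -
    have "f i \<in> M"
      unfolding M_def using that by (intro complex_vector.span_base) auto
    then show ?thesis
      using h[of "f i"] by (simp add: cinner_eq_zero_commute[of "f i"])
  qed
  ultimately have "cinner (f i) (inverse (cinner h h) *\<^sub>C h) = (if i = k then 1 else 0)" for i
    using \<open>h \<noteq> 0\<close> by (simp add: cinner_scaleC_right cinner_self)
  then show ?thesis by blast
qed

section \<open>Orthonormal systems: expansion and Parseval's identity\<close>

text \<open>Bessel's inequality gives convergence; \<open>x\<close> minus the sum is orthogonal to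
  every \<open>e j\<close>, hence 0. Totality is stated through orthogonal vectors because this form
  is directly verifiable for Gabor systems and Parseval frames.\<close>

lemma orthonormal_expansion:
  fixes e :: "'i \<Rightarrow> 'a::chilbert_space"
  assumes on: "\<And>i j. cinner (e i) (e j) = (if i = j then 1 else 0)"
    and total: "\<And>h. (\<And>i. cinner h (e i) = 0) \<Longrightarrow> h = 0"
  shows "((\<lambda>i. cinner x (e i) *\<^sub>C e i) has_sum x) UNIV"
proof -
  have upper: "(norm (\<Sum>i\<in>F. c i *\<^sub>C e i))\<^sup>2 \<le> 1 * (\<Sum>i\<in>F. (cmod (c i))\<^sup>2)" if "finite F" for F c
    using norm_sum_orthonormal[OF on that] by simp
  have "(\<Sum>i\<in>F. (cmod (cinner x (e i)))\<^sup>2) \<le> 1 * (norm x)\<^sup>2" if "finite F" for F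
  proof -
    have "cmod (cinner x (e i)) = cmod (cinner (e i) x)" for i
      by (subst cinner_commute) simp
    with sum_cinner_le[OF upper[OF that], of x] show ?thesis by simp
  qed
  then have "(\<lambda>i. cinner x (e i) *\<^sub>C e i) summable_on UNIV"
    by (intro summable_on_scaleC[OF upper] summable_on_square_bounded) auto
  then obtain z where z: "((\<lambda>i. cinner x (e i) *\<^sub>C e i) has_sum z) UNIV"
    by (auto simp: summable_on_def)
  have "cinner (x - z) (e j) = 0" for j
  proof -
    have "((\<lambda>i. cinner (cinner x (e i) *\<^sub>C e i) (e j)) has_sum cinner z (e j)) UNIV"
      by (rule has_sum_bounded_linear[OF bounded_linear_cinner_left z])
    moreover have "((\<lambda>i. cinner (cinner x (e i) *\<^sub>C e i) (e j)) has_sum cinner x (e j)) UNIV"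
      by (rule has_sum_finite_neutralI[where B = "{j}"]) (auto simp: cinner_scaleC_left on)
    ultimately have "cinner z (e j) = cinner x (e j)" by (rule has_sum_unique)
    then show ?thesis by (simp add: cinner_diff_left)
  qed
  then have "x - z = 0" by (rule total)
  with z show ?thesis by simp
qed

lemma has_sum_scaleC_in_closure_cspan:
  assumes "((\<lambda>i. c i *\<^sub>C e i) has_sum x) UNIV"
  shows "x \<in> closure (cspan (range e))"
proof (rule Lim_in_closed_set)
  show "((\<lambda>F. \<Sum>i\<in>F. c i *\<^sub>C e i) \<longlongrightarrow> x) (finite_subsets_at_top UNIV)"
    using assms by (simp add: has_sum_def)
  have "(\<Sum>i\<in>F. c i *\<^sub>C e i) \<in> cspan (range e)" for F
    by (intro complex_vector.span_sum complex_vector.span_scale complex_vector.span_base) auto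
  then show "\<forall>\<^sub>F F in finite_subsets_at_top UNIV. (\<Sum>i\<in>F. c i *\<^sub>C e i) \<in> closure (cspan (range e))"
    using closure_subset by (intro always_eventually) blast
qed auto

lemma has_sum_cinner_expansion:
  assumes "((\<lambda>i. c i *\<^sub>C e i) has_sum x) UNIV"
  shows "((\<lambda>i. c i * cinner (e i) y) has_sum cinner x y) UNIV"
  using has_sum_bounded_linear[OF bounded_linear_cinner_left assms, of y] by (simp add: cinner_scaleC_left)

text \<open>Pair the expansion of \<open>x\<close> with \<open>x\<close> itself: each term is the
  squared modulus of a coefficient.\<close>

lemma orthonormal_parseval_frame:
  fixes e :: "'i \<Rightarrow> 'a::chilbert_space"
  assumes "\<And>x. ((\<lambda>i. cinner x (e i) *\<^sub>C e i) has_sum x) UNIV"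
  shows "parseval_frame e"
  unfolding parseval_frame_def
proof
  fix x
  have "((\<lambda>i. cinner x (e i) * cinner (e i) x) has_sum cinner x x) UNIV"
    by (rule has_sum_cinner_expansion[OF assms])
  moreover have "cinner x (e i) * cinner (e i) x = complex_of_real ((cmod (cinner x (e i)))\<^sup>2)" for i
    unfolding complex_norm_square by (subst (2) cinner_commute) simp
  ultimately show "((\<lambda>i. (cmod (cinner x (e i)))\<^sup>2) has_sum (norm x)\<^sup>2) UNIV"
    by (simp only: cinner_self has_sum_of_real_iff)
qed

section \<open>Weak R-duals of Riesz bases\<close>

lemma orthonormal_basisI:
  fixes e :: "'i \<Rightarrow> 'a::chilbert_space"
  assumes "\<And>i j. cinner (e i) (e j) = (if i = j then 1 else 0)"
    and "\<And>h. (\<And>i. cinner h (e i) = 0) \<Longrightarrow> h = 0"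
  shows "orthonormal_basis e"
proof -
  have "x \<in> closure (cspan (range e))" for x
    using has_sum_scaleC_in_closure_cspan[OF orthonormal_expansion[of e x]] assms by blast
  then show ?thesis
    using assms(1) by (auto simp: orthonormal_basis_def)
qed

lemma parseval_frame_total:
  fixes u :: "'i \<Rightarrow> 'a::chilbert_space"
  assumes "parseval_frame u" "\<And>i. cinner x (u i) = 0"
  shows "x = 0"
proof -
  have "((\<lambda>i. (cmod (cinner x (u i)))\<^sup>2) has_sum (norm x)\<^sup>2) UNIV"
    using assms(1) by (simp add: parseval_frame_def)
  then have "((\<lambda>_. 0) has_sum (norm x)\<^sup>2) (UNIV :: 'i set)"
    by (simp add: assms(2))
  from has_sum_unique[OF this has_sum_0_simp] show ?thesis by simp
qed

text \<open>Polarization of the frame identity: the cases \<open>c = 1\<close> and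
  \<open>c = \<i>\<close> of \<open>polar\<close> give the real and the imaginary part.\<close>

lemma parseval_frame_cinner:
  assumes "parseval_frame u"
  shows "((\<lambda>i. cinner (u i) y * cinner x (u i)) has_sum cinner x y) UNIV"
proof -
  define p where "p i = cinner x (u i) * cnj (cinner y (u i))" for i
  have frame: "((\<lambda>i. (cmod (cinner x (u i)))\<^sup>2) has_sum (norm x)\<^sup>2) UNIV" for x
    using assms(1) by (simp add: parseval_frame_def)
  \<comment> \<open>The frame identities for \<open>x\<close> and \<open>c *\<^sub>C y\<close> are
    subtracted from the one for their sum, which leaves the cross terms.\<close>
  have polar: "((\<lambda>i. 2 * Re (cnj c * p i)) has_sum 2 * Re (cnj c * cinner x y)) UNIV" for c
  proof -
    have "((\<lambda>i. (cmod (cinner (x + c *\<^sub>C y) (u i)))\<^sup>2 +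
        (- 1) * ((cmod (cinner x (u i)))\<^sup>2 + (cmod c)\<^sup>2 * (cmod (cinner y (u i)))\<^sup>2)) has_sum
        ((norm (x + c *\<^sub>C y))\<^sup>2 + (- 1) * ((norm x)\<^sup>2 + (cmod c)\<^sup>2 * (norm y)\<^sup>2))) UNIV"
      by (intro has_sum_add has_sum_cmult_right frame)
    moreover have "(cmod (cinner (x + c *\<^sub>C y) (u i)))\<^sup>2 +
        (- 1) * ((cmod (cinner x (u i)))\<^sup>2 + (cmod c)\<^sup>2 * (cmod (cinner y (u i)))\<^sup>2) = 2 * Re (cnj c * p i)" for i
      unfolding p_def cinner_add_left cinner_scaleC_left
      by (simp only: cmod_power2) (simp add: power2_eq_square algebra_simps)
    ultimately show ?thesis
      by (simp only: norm_add_scaleC_square) simp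
  qed
  have "((\<lambda>i. complex_of_real (1 / 2 * (2 * Re (cnj 1 * p i))) + \<i> * complex_of_real (1 / 2 * (2 * Re (cnj \<i> * p i))))
      has_sum (complex_of_real (1 / 2 * (2 * Re (cnj 1 * cinner x y)))
        + \<i> * complex_of_real (1 / 2 * (2 * Re (cnj \<i> * cinner x y))))) UNIV"
    by (intro has_sum_add has_sum_cmult_right has_sum_of_real polar)
  moreover have "complex_of_real (1 / 2 * (2 * Re (cnj 1 * z))) + \<i> * complex_of_real (1 / 2 * (2 * Re (cnj \<i> * z))) = z" for z
    by (simp add: complex_eq_iff)
  moreover have "p i = cinner (u i) y * cinner x (u i)" for i
    unfolding p_def by (subst cinner_commute[of "u i"]) (rule mult.commute)
  ultimately show ?thesis by (simp only:)
qed

text \<open>The vector synthesized from \<open>f\<close> with the coefficients \<open>c\<close> is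
  orthogonal to every \<open>u j\<close>. It vanishes because a Parseval frame is total, and the
  lower Riesz bound then annihilates the coefficients.\<close>

lemma riesz_basis_coeff_eq_zero:
  fixes f :: "'i \<Rightarrow> 'a::chilbert_space"
  assumes "riesz_basis f" "parseval_frame u" "(\<lambda>i. (cmod (c i))\<^sup>2) summable_on UNIV"
    and orth: "\<And>j. ((\<lambda>i. c i * cinner (f i) (u j)) has_sum 0) UNIV"
  shows "c k = 0"
proof -
  obtain A B where "0 < A" "A \<le> B"
    and lower: "\<And>F c. finite F \<Longrightarrow> A * (\<Sum>i\<in>F. (cmod (c i))\<^sup>2) \<le> (norm (\<Sum>i\<in>F. c i *\<^sub>C f i))\<^sup>2"
    and upper: "\<And>F c. finite F \<Longrightarrow> (norm (\<Sum>i\<in>F. c i *\<^sub>C f i))\<^sup>2 \<le> B * (\<Sum>i\<in>F. (cmod (c i))\<^sup>2)"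
    using assms(1) unfolding riesz_basis_def by blast
  have "(\<lambda>i. c i *\<^sub>C f i) summable_on UNIV"
    by (rule summable_on_scaleC[OF upper]) (use \<open>0 < A\<close> \<open>A \<le> B\<close> assms(3) in auto)
  then obtain z where z: "((\<lambda>i. c i *\<^sub>C f i) has_sum z) UNIV"
    by (auto simp: summable_on_def)
  have "cinner z (u j) = 0" for j
    using has_sum_cinner_expansion[OF z] orth by (rule has_sum_unique)
  then have "z = 0"
    using assms(2) by (intro parseval_frame_total)
  then have "A * (cmod (c k))\<^sup>2 \<le> 0"
    using coeff_le_norm_has_sum[OF lower _ z, of k] \<open>0 < A\<close> by simp
  then show ?thesis
    using \<open>0 < A\<close> by (simp add: mult_le_0_iff)
qed

text \<open>By \<open>inv\<close>, the Kronecker sequence at \<open>i\<close> and the Gram row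
  \<open>cinner (v k) (v i)\<close> have the same sums against \<open>cinner (f k) (u j)\<close> for
  all \<open>j\<close>. Their difference is square summable, as \<open>v\<close> is a Parseval
  frame, so it is zero.\<close>

lemma parseval_frame_orthonormal:
  fixes f :: "'i \<Rightarrow> 'a::chilbert_space"
  assumes "riesz_basis f" "parseval_frame u" "parseval_frame v"
    and inv: "\<And>i j. ((\<lambda>k. cinner (v k) (v i) * cinner (f k) (u j)) has_sum cinner (f i) (u j)) UNIV"
  shows "orthonormal_basis v"
proof (rule orthonormal_basisI)
  fix k i
  define d where "d k = (if k = i then 1 else 0) - cinner (v k) (v i)" for k
  have "d k = 0"
  proof (rule riesz_basis_coeff_eq_zero[OF assms(1,2)])
    have "((\<lambda>k. (cmod (cinner (v i) (v k)))\<^sup>2) has_sum (norm (v i))\<^sup>2) UNIV"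
      using assms(3) by (simp add: parseval_frame_def)
    moreover have "cmod (cinner (v i) (v k)) = cmod (cinner (v k) (v i))" for k
      by (subst cinner_commute) simp
    ultimately have "(\<lambda>k. 2 * (cmod (cinner (v k) (v i)))\<^sup>2) summable_on UNIV"
      by (intro summable_on_cmult_right) (auto simp: summable_on_def)
    moreover have "((\<lambda>k. if k = i then 2 else 0 :: real) has_sum 2) UNIV"
      by (rule has_sum_finite_neutralI[where B = "{i}"]) auto
    ultimately have "(\<lambda>k. (if k = i then 2 else 0) + 2 * (cmod (cinner (v k) (v i)))\<^sup>2) summable_on UNIV"
      by (intro summable_on_add) (auto simp: summable_on_def)
    then show "(\<lambda>k. (cmod (d k))\<^sup>2) summable_on UNIV"
    proof (rule summable_on_comparison_test)
      fix k
      have "(cmod (d k))\<^sup>2 \<le> (cmod (if k = i then 1 else 0) + cmod (cinner (v k) (v i)))\<^sup>2"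
        unfolding d_def by (intro power_mono norm_triangle_ineq4) auto
      also have "\<dots> \<le> 2 * (cmod (if k = i then 1 else 0))\<^sup>2 + 2 * (cmod (cinner (v k) (v i)))\<^sup>2"
        using sum_squares_bound[of "cmod (if k = i then 1 else 0)" "cmod (cinner (v k) (v i))"]
        by (simp only: power2_sum)
      finally show "(cmod (d k))\<^sup>2 \<le> (if k = i then 2 else 0) + 2 * (cmod (cinner (v k) (v i)))\<^sup>2"
        by (auto split: if_splits)
    qed auto
    show "((\<lambda>k. d k * cinner (f k) (u j)) has_sum 0) UNIV" for j
    proof -
      have "((\<lambda>k. (if k = i then 1 else 0) * cinner (f k) (u j)) has_sum cinner (f i) (u j)) UNIV"
        by (rule has_sum_finite_neutralI[where B = "{i}"]) auto
      from has_sum_add[OF this has_sum_cmult_right[OF inv[of i j], of "- 1"]]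
      show ?thesis
        by (simp add: d_def left_diff_distrib)
    qed
  qed
  then show "cinner (v k) (v i) = (if k = i then 1 else 0)"
    by (simp add: d_def)
qed (rule parseval_frame_total[OF assms(3)])

lemma weak_R_dual_orthonormal:
  fixes f w :: "'i \<Rightarrow> 'a::chilbert_space"
  assumes "riesz_basis f" "riesz_basis w" "is_weak_R_dual w f u v"
  shows "orthonormal_basis u \<and> orthonormal_basis v"
proof -
  from assms(3) have u: "parseval_frame u" and v: "parseval_frame v"
    and inv: "\<And>i j. ((\<lambda>k. cinner (v k) (v i) * cinner (f k) (u j)) has_sum cinner (f i) (u j)) UNIV"
    and w: "\<And>j. ((\<lambda>i. cinner (f i) (u j) *\<^sub>C v i) has_sum w j) UNIV"
    unfolding is_weak_R_dual_def by blast+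
  \<comment> \<open>Pairing the series for \<open>w j\<close> with \<open>v i\<close> gives exactly
    the sum evaluated in \<open>inv\<close>.\<close>
  have eq: "cinner (w j) (v i) = cinner (f i) (u j)" for i j
    using has_sum_cinner_expansion[OF w, of j "v i"] inv[of i j]
    by (simp add: mult.commute has_sum_unique)
  \<comment> \<open>By \<open>eq\<close> this is the polarized frame identity of \<open>u\<close>
    for \<open>f i\<close> and \<open>u k\<close>. It is the hypothesis \<open>inv\<close> with
    \<open>w\<close> in place of \<open>f\<close> and with \<open>u\<close> and \<open>v\<close>
    exchanged.\<close>
  have "((\<lambda>j. cinner (u j) (u k) * cinner (w j) (v i)) has_sum cinner (w k) (v i)) UNIV" for i k
    unfolding eq by (rule parseval_frame_cinner[OF u])
  then show ?thesis
    using parseval_frame_orthonormal[OF assms(1) u v inv]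
      parseval_frame_orthonormal[OF assms(2) v u] by blast
qed

section \<open>Completeness of the trigonometric system\<close>

lemma integral_cis_period:
  fixes k :: int
  assumes "b > 0"
  shows "(LINT t|lborel. indicator {\<alpha>..<\<alpha> + 1 / b} t *\<^sub>R cis (2 * pi * (of_int k * b) * t)) =
    (if k = 0 then complex_of_real (1 / b) else 0)"
proof (cases "k = 0")
  case True
  then show ?thesis using assms by (simp add: scaleR_conv_of_real)
next
  case False
  define c where "c = 2 * pi * (of_int k * b)"
  have "c \<noteq> 0" using False assms by (simp add: c_def)
  have "has_bochner_integral lborel (\<lambda>t. indicator {\<alpha>..\<alpha> + 1 / b} t *\<^sub>R cis (c * t))
      (cis (c * (\<alpha> + 1 / b)) / (\<i> * c) - cis (c * \<alpha>) / (\<i> * c))"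
  proof (rule has_bochner_integral_FTC_Icc)
    fix t
    have "((\<lambda>t. cis (c * t) / (\<i> * c)) has_vector_derivative (c *\<^sub>R (\<i> * cis (c * t))) / (\<i> * c)) (at t within {\<alpha>..\<alpha> + 1 / b})"
      by (rule has_vector_derivative_divide, unfold has_vector_derivative_def)
        (auto intro!: derivative_eq_intros simp: scaleR_conv_of_real mult_ac)
    then show "((\<lambda>t. cis (c * t) / (\<i> * c)) has_vector_derivative cis (c * t)) (at t within {\<alpha>..\<alpha> + 1 / b})"
      using \<open>c \<noteq> 0\<close> by (simp add: scaleR_conv_of_real)
  qed (use assms in \<open>auto intro!: continuous_intros\<close>)
  then have "(LINT t|lborel. indicator {\<alpha>..\<alpha> + 1 / b} t *\<^sub>R cis (c * t)) =
      cis (c * (\<alpha> + 1 / b)) / (\<i> * c) - cis (c * \<alpha>) / (\<i> * c)"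
    by (rule has_bochner_integral_integral_eq)
  also have "cis (c * (\<alpha> + 1 / b)) = cis (c * \<alpha>) * cis (2 * pi * of_int k)"
  proof -
    have "c * (\<alpha> + 1 / b) = c * \<alpha> + 2 * pi * of_int k"
      using assms by (simp add: c_def distrib_left)
    then show ?thesis by (simp only: cis_mult)
  qed
  also have "cis (2 * pi * of_int k) = 1"
    by (rule cis_multiple_2pi) simp
  \<comment> \<open>The fundamental theorem was applied on the closed interval; dropping the right
    endpoint changes the integrand only on a null set.\<close>
  also have "(LINT t|lborel. indicator {\<alpha>..\<alpha> + 1 / b} t *\<^sub>R cis (c * t)) =
      (LINT t|lborel. indicator {\<alpha>..<\<alpha> + 1 / b} t *\<^sub>R cis (c * t))"
  proof (rule integral_cong_AE)
    have "(\<lambda>t. cis (c * t)) \<in> borel_measurable borel"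
      by (intro borel_measurable_continuous_onI continuous_intros)
    then show "(\<lambda>t. indicator {\<alpha>..\<alpha> + 1 / b} t *\<^sub>R cis (c * t)) \<in> borel_measurable lborel"
      "(\<lambda>t. indicator {\<alpha>..<\<alpha> + 1 / b} t *\<^sub>R cis (c * t)) \<in> borel_measurable lborel"
      by measurable
    show "AE t in lborel. indicator {\<alpha>..\<alpha> + 1 / b} t *\<^sub>R cis (c * t) =
        indicator {\<alpha>..<\<alpha> + 1 / b} t *\<^sub>R cis (c * t)"
      using AE_lborel_singleton[of "\<alpha> + 1 / b"] by eventually_elim (auto simp: indicator_def)
  qed
  finally show ?thesis
    using False by (simp add: c_def)
qed

text \<open>Half-lines form an intersection-stable generator of the Borel sets, and the sets over
  which \<open>q\<close> integrates to 0 are closed under complements, by the hypothesis on the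
  whole line, and under countable disjoint unions.\<close>

lemma AE_eq_0_if_integral_atMost_0:
  fixes q :: "real \<Rightarrow> complex"
  assumes q: "integrable lborel q" and 0: "integral\<^sup>L lborel q = 0"
    and atMost: "\<And>x. (LINT t:{..x}|lborel. q t) = 0"
  shows "AE t in lborel. q t = 0"
proof (rule sigma_finite_measure.density_zero[OF sigma_finite_lborel q])
  have int: "set_integrable lborel A q" if "A \<in> sets borel" for A
    unfolding set_integrable_def using q that by (intro integrable_mult_indicator) auto
  fix A :: "real set"
  assume A: "A \<in> sets lborel"
  have borel: "sets borel = sigma_sets UNIV (range (\<lambda>x::real. {..x}))"
    by (subst borel_eq_atMost) (simp add: sets_measure_of)
  show "(LINT t:A|lborel. q t) = 0"
  proof (rule sigma_sets_induct_disjoint[of "range (\<lambda>x::real. {..x})" UNIV A])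
    show "Int_stable (range (\<lambda>x::real. {..x}))"
      by (auto simp: Int_stable_def)
    show "A \<in> sigma_sets UNIV (range (\<lambda>x::real. {..x}))"
      using A borel by simp
  next
    fix A :: "real set" assume "A \<in> sigma_sets UNIV (range (\<lambda>x::real. {..x}))" "(LINT t:A|lborel. q t) = 0"
    then have A: "A \<in> sets borel" "(LINT t:A|lborel. q t) = 0" by (simp_all add: borel)
    have "(LINT t:A \<union> (UNIV - A)|lborel. q t) = (LINT t:A|lborel. q t) + (LINT t:UNIV - A|lborel. q t)"
      by (intro set_integral_Un int) (use A in auto)
    with A 0 show "(LINT t:UNIV - A|lborel. q t) = 0"
      by (simp add: set_lebesgue_integral_def)
  next
    fix A :: "nat \<Rightarrow> real set"
    assume disj: "disjoint_family A" and A: "range A \<subseteq> sigma_sets UNIV (range (\<lambda>x::real. {..x}))"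
      and zero: "\<And>i. (LINT t:A i|lborel. q t) = 0"
    then have "A i \<in> sets borel" for i by (auto simp: borel)
    then have "(LINT t:\<Union> (range A)|lborel. q t) = (\<Sum>i. (LINT t:A i|lborel. q t))"
      using disj by (intro lebesgue_integral_countable_add int) (auto simp: disjoint_family_on_def)
    then show "(LINT t:\<Union> (range A)|lborel. q t) = 0"
      by (simp add: zero)
  qed (auto simp: atMost set_lebesgue_integral_def[of _ "{}"])
qed

text \<open>Uniqueness of Fourier coefficients for integrable functions on one period, viewed on the
  unit circle via \<open>z\<close>. The integral of \<open>q\<close> vanishes successively against
  polynomials, continuous functions by Stone-Weierstrass, and indicators of closed sets. Closed arcs
  yield the integrals over half-lines.\<close>

lemma AE_eq_0_if_fourier_coeffs_0:
  fixes q :: "real \<Rightarrow> complex"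
  assumes "b > 0" and q: "integrable lborel q"
    and supp: "\<And>t. t \<notin> {\<alpha>..<\<alpha> + 1 / b} \<Longrightarrow> q t = 0"
    and coeff: "\<And>m::int. (LINT t|lborel. q t * cis (2 * pi * (of_int m * b) * t)) = 0"
  shows "AE t in lborel. q t = 0"
proof -
  define z where "z t = cis (2 * pi * b * t)" for t
  have z_meas: "z \<in> borel_measurable borel"
    unfolding z_def by (intro borel_measurable_continuous_onI continuous_intros)
  have z_sphere: "z t \<in> sphere 0 1" for t by (simp add: z_def)
  \<comment> \<open>The class of functions with vanishing Fourier coefficients. Its closure under
    linear combinations and modulations gives closure under multiplication by real polynomials in
    \<open>z t\<close>.\<close>
  define \<N> where "\<N> r \<longleftrightarrow> integrable lborel r \<and>
    (\<forall>m::int. (LINT t|lborel. r t * cis (2 * pi * (of_int m * b) * t)) = 0)" for r :: "real \<Rightarrow> complex"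
  have cis_int: "integrable lborel (\<lambda>t. r t * cis (x * t))" if "integrable lborel r" for r :: "real \<Rightarrow> complex" and x
  proof (rule Bochner_Integration.integrable_bound[OF that])
    have "(\<lambda>t. cis (x * t)) \<in> borel_measurable borel"
      by (intro borel_measurable_continuous_onI continuous_intros)
    then show "(\<lambda>t. r t * cis (x * t)) \<in> borel_measurable lborel"
      using that by (intro borel_measurable_times) auto
  qed (auto simp: norm_mult)
  have N_add: "\<N> (\<lambda>t. r t + r' t)" if "\<N> r" "\<N> r'" for r r'
    using that cis_int by (auto simp: \<N>_def distrib_right)
  have N_cmult: "\<N> (\<lambda>t. c * r t)" if "\<N> r" for r c
    using that by (auto simp: \<N>_def mult.assoc)
  have N_cis: "\<N> (\<lambda>t. r t * cis (2 * pi * (of_int k * b) * t))" if "\<N> r" for r k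
    unfolding \<N>_def
  proof (intro conjI allI)
    show "integrable lborel (\<lambda>t. r t * cis (2 * pi * (of_int k * b) * t))"
      using that by (intro cis_int) (simp add: \<N>_def)
    fix m :: int
    have "(LINT t|lborel. r t * cis (2 * pi * (of_int (k + m) * b) * t)) = 0"
      using that unfolding \<N>_def by blast
    then show "(LINT t|lborel. r t * cis (2 * pi * (of_int k * b) * t) * cis (2 * pi * (of_int m * b) * t)) = 0"
      by (simp add: mult.assoc cis_mult algebra_simps)
  qed
  have N_poly: "\<N> (\<lambda>t. complex_of_real (p (z t)) * r t)" if "real_polynomial_function p" "\<N> r" for p r
    using that
  proof (induction p arbitrary: r rule: real_polynomial_function.induct)
    case (linear h)
    \<comment> \<open>Euler's formulas: \<open>c + d\<close> and \<open>c - d\<close> are the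
      coefficients of the frequencies 1 and -1 in \<open>h (z t)\<close>, which is
      \<open>h 1\<close> times the cosine plus \<open>h \<i>\<close> times the sine.\<close>
    define c where "c = complex_of_real (h 1) / 2"
    define d where "d = - \<i> * complex_of_real (h \<i> / 2)"
    have "complex_of_real (h (z t)) * r t =
        (c + d) * (r t * cis (2 * pi * (of_int 1 * b) * t)) + (c - d) * (r t * cis (2 * pi * (of_int (- 1) * b) * t))" for t
    proof -
      have "h (z t) = h (cos (2 * pi * b * t) *\<^sub>R 1 + sin (2 * pi * b * t) *\<^sub>R \<i>)"
        by (rule arg_cong[where f=h]) (simp add: z_def complex_eq_iff)
      also have "\<dots> = cos (2 * pi * b * t) * h 1 + sin (2 * pi * b * t) * h \<i>"
        by (simp only: bounded_linear.linear[OF linear(1), THEN linear_add] bounded_linear.linear[OF linear(1), THEN linear_scale] real_scaleR_def)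
      finally show ?thesis
        by (simp add: c_def d_def complex_eq_iff algebra_simps add_divide_distrib diff_divide_distrib)
    qed
    then show ?case
      using linear(2) by (simp only:) (intro N_add N_cmult N_cis)
  next
    case (const c)
    then show ?case by (rule N_cmult)
  next
    case (add f g)
    then show ?case
      by (simp only: of_real_add distrib_right) (intro N_add; blast)
  next
    case (mult f g)
    then show ?case by (simp only: of_real_mult mult.assoc)
  qed
  have norm_le: "\<bar>x\<bar> * cmod y \<le> K * cmod y" if "\<bar>x\<bar> \<le> K" for x y K
    using that by (rule mult_right_mono) simp
  have cont: "(LINT t|lborel. complex_of_real (g (z t)) * q t) = 0"
    if g: "continuous_on (sphere 0 1) g" and gm: "(\<lambda>t. g (z t)) \<in> borel_measurable borel" for g :: "complex \<Rightarrow> real"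
  proof (rule ccontr)
    let ?I = "LINT t|lborel. complex_of_real (g (z t)) * q t"
    let ?K = "LINT t|lborel. cmod (q t)"
    assume "?I \<noteq> 0"
    \<comment> \<open>An approximation error below \<open>e\<close> changes the integral by at most
      \<open>e * ?K\<close>, which is less than \<open>cmod ?I\<close>. The summand 1 keeps the
      denominator positive.\<close>
    define e where "e = cmod ?I / (?K + 1)"
    have "?K \<ge> 0" by simp
    with \<open>?I \<noteq> 0\<close> have "e > 0" by (simp add: e_def add_nonneg_pos)
    from Stone_Weierstrass_real_polynomial_function[OF _ g this] obtain p
      where p: "real_polynomial_function p" and close: "\<And>x. x \<in> sphere 0 1 \<Longrightarrow> \<bar>g x - p x\<bar> < e"
      by auto
    have "\<N> (\<lambda>t. complex_of_real (p (z t)) * q t)"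
      using q coeff by (intro N_poly p) (auto simp: \<N>_def)
    then have pint: "integrable lborel (\<lambda>t. complex_of_real (p (z t)) * q t)"
      and "\<forall>m::int. (LINT t|lborel. complex_of_real (p (z t)) * q t * cis (2 * pi * (of_int m * b) * t)) = 0"
      by (simp_all add: \<N>_def)
    from this(2)[rule_format, of 0] have p0: "(LINT t|lborel. complex_of_real (p (z t)) * q t) = 0"
      by simp
    have "(\<lambda>t. p (z t)) \<in> borel_measurable borel"
      using z_meas borel_measurable_continuous_onI[OF continuous_on_polymonial_function, of p] p
      by (simp add: real_polynomial_function_eq)
    then have dint: "integrable lborel (\<lambda>t. complex_of_real (g (z t) - p (z t)) * q t)"
      using gm q close[OF z_sphere]
      by (intro Bochner_Integration.integrable_bound[OF integrable_mult_right[OF integrable_norm[OF q], of e]])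
        (auto simp: norm_mult abs_mult intro!: AE_I2 norm_le order.trans[OF less_imp_le abs_ge_self] simp del: of_real_diff)
    have close_le: "\<bar>g (z t) - p (z t)\<bar> \<le> e" for t
      using close[OF z_sphere] by (rule less_imp_le)
    have "?I = (LINT t|lborel. complex_of_real (g (z t) - p (z t)) * q t + complex_of_real (p (z t)) * q t)"
      by (simp add: algebra_simps)
    also have "\<dots> = (LINT t|lborel. complex_of_real (g (z t) - p (z t)) * q t)"
      by (subst Bochner_Integration.integral_add[OF dint pint]) (simp add: p0)
    also have "cmod \<dots> \<le> (LINT t|lborel. cmod (complex_of_real (g (z t) - p (z t)) * q t))"
      by (rule integral_norm_bound)
    also have "\<dots> \<le> (LINT t|lborel. e * cmod (q t))"
      by (intro integral_mono integrable_norm dint integrable_mult_right q)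
        (auto simp: norm_mult intro!: norm_le close_le simp del: of_real_diff)
    also have "\<dots> = e * ?K" by simp
    also have "\<dots> < e * (?K + 1)"
      using \<open>e > 0\<close> by simp
    also have "\<dots> = cmod ?I"
    proof -
      have "?K + 1 \<noteq> 0" using \<open>?K \<ge> 0\<close> by linarith
      then show ?thesis by (simp add: e_def)
    qed
    finally show False by simp
  qed
  have closed: "(LINT t|lborel. complex_of_real (indicator C (z t)) * q t) = 0" if C: "closed C" "C \<noteq> {}" for C
  proof -
    \<comment> \<open>Continuous functions converging pointwise to the indicator of
      \<open>C\<close>; as \<open>C\<close> is closed and nonempty, \<open>infdist x C\<close> is
      positive off \<open>C\<close>.\<close>
    define g where "g k x = max 0 (1 - real k * infdist x C)" for k and x :: complex
    have g_cont: "continuous_on UNIV (g k)" for k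
      unfolding g_def by (intro continuous_intros)
    have g_meas: "(\<lambda>t. g k (z t)) \<in> borel_measurable borel" for k
      using z_meas borel_measurable_continuous_onI[OF g_cont] by simp
    have g_lim: "(\<lambda>k. g k x) \<longlonglongrightarrow> indicator C x" for x
    proof (cases "x \<in> C")
      case True
      then show ?thesis by (simp add: g_def)
    next
      case False
      then have pos: "infdist x C > 0"
        using C by (simp add: in_closed_iff_infdist_zero infdist_nonneg order_less_le)
      obtain N where N: "1 / infdist x C < real N" using reals_Archimedean2 by blast
      have "g k x = 0" if "k \<ge> N" for k
      proof -
        have "1 < real N * infdist x C" using N pos by (simp add: field_simps)
        also have "\<dots> \<le> real k * infdist x C" using that pos by (intro mult_right_mono) auto
        finally show ?thesis by (simp add: g_def)
      qed
      then have "(\<lambda>k. g k x) \<longlonglongrightarrow> 0"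
        by (intro tendsto_eventually) (auto simp: eventually_sequentially)
      with False show ?thesis by simp
    qed
    have g_bound: "\<bar>g k x\<bar> \<le> 1" for k x
      by (simp add: g_def infdist_nonneg)
    have "(\<lambda>k. LINT t|lborel. complex_of_real (g k (z t)) * q t) \<longlonglongrightarrow>
        (LINT t|lborel. complex_of_real (indicator C (z t)) * q t)"
    proof (rule integral_dominated_convergence)
      show "integrable lborel (\<lambda>t. cmod (q t))" using q by simp
      show "(\<lambda>t. complex_of_real (g k (z t)) * q t) \<in> borel_measurable lborel" for k
        using g_meas q by measurable
      have "(indicator C :: complex \<Rightarrow> real) \<in> borel_measurable borel"
        using C(1) by (intro borel_measurable_indicator borel_closed)
      then have "(\<lambda>t. indicator C (z t) :: real) \<in> borel_measurable borel"
        by (rule measurable_compose[OF z_meas])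
      then show "(\<lambda>t. complex_of_real (indicator C (z t)) * q t) \<in> borel_measurable lborel"
        using q by measurable
      show "AE t in lborel. (\<lambda>k. complex_of_real (g k (z t)) * q t) \<longlonglongrightarrow> complex_of_real (indicator C (z t)) * q t"
        by (intro AE_I2 tendsto_intros g_lim)
      show "AE t in lborel. cmod (complex_of_real (g k (z t)) * q t) \<le> cmod (q t)" for k
        using norm_le[OF g_bound] by (intro AE_I2) (simp add: norm_mult)
    qed
    moreover have "(LINT t|lborel. complex_of_real (g k (z t)) * q t) = 0" for k
      by (intro cont g_meas continuous_on_subset[OF g_cont]) simp
    ultimately show ?thesis
      using LIMSEQ_unique[OF _ tendsto_const[of 0]] by simp
  qed
  have total: "integral\<^sup>L lborel q = 0"
    using coeff[of 0] by simp
  show ?thesis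
  proof (rule AE_eq_0_if_integral_atMost_0[OF q total])
    fix x
    consider "x < \<alpha>" | "x \<ge> \<alpha> + 1 / b" | "\<alpha> \<le> x" "x < \<alpha> + 1 / b" by linarith
    then show "(LINT t:{..x}|lborel. q t) = 0"
    proof cases
      case 1
      then have "indicator {..x} t *\<^sub>R q t = 0" for t
        using supp[of t] by (auto simp: indicator_def)
      then show ?thesis by (simp only: set_lebesgue_integral_def integral_zero)
    next
      case 2
      then have "indicator {..x} t *\<^sub>R q t = q t" for t
        using supp[of t] by (auto simp: indicator_def)
      then show ?thesis by (simp only: set_lebesgue_integral_def total)
    next
      case 3
      \<comment> \<open>Within the half-open period, where \<open>z\<close> is injective, the
        preimage of this closed arc is exactly the part up to \<open>x\<close>.\<close>
      define C where "C = z ` {\<alpha>..x}"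
      have "compact C"
        unfolding C_def z_def by (intro compact_continuous_image continuous_intros) auto
      then have C: "closed C" "C \<noteq> {}"
        using 3 by (auto simp: C_def compact_imp_closed)
      have "indicator {..x} t *\<^sub>R q t = complex_of_real (indicator C (z t)) * q t" for t
      proof (cases "t \<in> {\<alpha>..<\<alpha> + 1 / b}")
        case True
        have "z t \<in> C \<longleftrightarrow> t \<le> x"
        proof
          assume "z t \<in> C"
          then obtain t' where t': "t' \<in> {\<alpha>..x}" "z t = z t'" by (auto simp: C_def)
          then have "cis (2 * pi * b * t - 2 * pi * b * t') = 1"
            by (simp add: z_def flip: cis_divide)
          then have "cos (2 * pi * b * t - 2 * pi * b * t') = 1"
            by (metis cis.simps(1) one_complex.simps(1))
          then obtain n :: int where "2 * pi * b * t - 2 * pi * b * t' = of_int n * 2 * pi"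
            by (auto simp: cos_one_2pi_int)
          then have "2 * pi * (b * (t - t')) = 2 * pi * of_int n"
            by (simp add: algebra_simps)
          then have n: "b * (t - t') = of_int n" by simp
          have "\<bar>t - t'\<bar> < 1 / b"
            using True t' 3 by (auto simp: abs_less_iff)
          then have "\<bar>b * (t - t')\<bar> < 1"
            using \<open>b > 0\<close> by (simp only: abs_mult abs_of_pos pos_less_divide_eq mult.commute)
          then have "n = 0" unfolding n by linarith
          with n \<open>b > 0\<close> t' show "t \<le> x" by simp
        next
          assume "t \<le> x"
          then show "z t \<in> C" using True by (auto simp: C_def)
        qed
        then show ?thesis by (simp add: indicator_def)
      qed (simp add: supp)
      then show ?thesis
        using closed[OF C] by (simp only: set_lebesgue_integral_def)
    qed
  qed
qed

section \<open>Gabor systems of indicator functions\<close>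

lemma L2R_cases:
  obtains F where "square_integrable F" "x = abs_L2R F"
  using square_integrable_rep_L2R[of x] Quotient3_abs_rep[OF Quotient3_L2R, of x] that by metis

lemma cinner_abs_L2R:
  "square_integrable F \<Longrightarrow> square_integrable G \<Longrightarrow>
    cinner (abs_L2R F) (abs_L2R G) = (LINT t|lborel. F t * cnj (G t))"
  by (simp add: cinner_L2R.abs_eq)

lemma abs_L2R_eq_0:
  assumes "square_integrable F" "AE t in lborel. F t = 0"
  shows "abs_L2R F = 0"
proof -
  have "cinner (abs_L2R F) (abs_L2R F) = 0"
    unfolding cinner_abs_L2R[OF assms(1,1)] using assms(2)
    by (intro integral_eq_zero_AE) (auto elim!: eventually_mono)
  then show ?thesis by (simp add: cinner_self)
qed

lemma gabor_abs_L2R: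
  assumes "square_integrable F"
  shows "gabor a b (abs_L2R F) (m, n) =
    abs_L2R (\<lambda>t. cis (2 * pi * (of_int m * b) * t) * F (t - of_int n * a))"
  using assms by (simp add: gabor_def translation.abs_eq modulation.abs_eq square_integrable_translate)

lemma gabor_zero: "gabor a b f (0, 0) = f"
proof -
  obtain F where "square_integrable F" "f = abs_L2R F" by (rule L2R_cases)
  then show ?thesis by (simp add: gabor_abs_L2R)
qed

lemma square_integrable_gabor:
  assumes "square_integrable F"
  shows "square_integrable (\<lambda>t. cis (2 * pi * x * t) * F (t - y))"
  using assms by (intro square_integrable_modulate square_integrable_translate)

lemma square_integrable_indicator:
  assumes "square_integrable F" "A \<in> sets borel"
  shows "square_integrable (\<lambda>t. indicator A t *\<^sub>R F t)"
proof -
  have [measurable]: "F \<in> borel_measurable borel" "A \<in> sets borel"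
    using assms by (simp_all add: square_integrable_def)
  have int: "integrable lborel (\<lambda>t. (cmod (F t))\<^sup>2)"
    using assms by (simp add: square_integrable_def)
  have "integrable lborel (\<lambda>t. (cmod (indicator A t *\<^sub>R F t))\<^sup>2)"
    by (rule Bochner_Integration.integrable_bound[OF int]) (auto simp: indicator_def)
  then show ?thesis by (simp add: square_integrable_def)
qed

lemma square_integrable_const_indicator:
  "square_integrable (\<lambda>t. indicator {\<alpha>..<\<beta>} t *\<^sub>R c)"
proof -
  have "integrable lborel (\<lambda>t. indicator {\<alpha>..<\<beta>} t *\<^sub>R (cmod c)\<^sup>2)"
    by (cases "\<alpha> \<le> \<beta>") auto
  moreover have "(cmod (indicator {\<alpha>..<\<beta>} t *\<^sub>R c))\<^sup>2 = indicator {\<alpha>..<\<beta>} t *\<^sub>R (cmod c)\<^sup>2" for t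
    by (auto simp: indicator_def)
  ultimately show ?thesis
    by (simp add: square_integrable_def)
qed

text \<open>Translating the integration variable by \<open>of_int n' * a\<close> leaves a phase and
  the difference of the indices. The phase is 1 for equal indices, so biorthogonality to a single
  window extends to its whole Gabor system.\<close>

lemma cinner_gabor_gabor:
  "cinner (gabor a b f (m, n)) (gabor a b g (m', n')) =
    cis (2 * pi * (of_int (m - m') * b) * (of_int n' * a)) * cinner (gabor a b f (m - m', n - n')) g"
proof -
  obtain F where F: "square_integrable F" "f = abs_L2R F" by (rule L2R_cases)
  obtain G where G: "square_integrable G" "g = abs_L2R G" by (rule L2R_cases)
  have "cinner (gabor a b f (m, n)) (gabor a b g (m', n')) =
     (LINT t|lborel. cis (2 * pi * (of_int m * b) * t) * F (t - of_int n * a) *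
       cnj (cis (2 * pi * (of_int m' * b) * t) * G (t - of_int n' * a)))"
    using F G by (simp only: gabor_abs_L2R cinner_abs_L2R square_integrable_gabor)
  also have "\<dots> = (LINT t|lborel. cis (2 * pi * (of_int m * b) * (of_int n' * a + 1 * t)) * F (of_int n' * a + 1 * t - of_int n * a) *
       cnj (cis (2 * pi * (of_int m' * b) * (of_int n' * a + 1 * t)) * G (of_int n' * a + 1 * t - of_int n' * a)))"
    by (subst lborel_integral_real_affine[where c = 1 and t = "of_int n' * a"]) simp_all
  also have "\<dots> = (LINT t|lborel. cis (2 * pi * (of_int (m - m') * b) * (of_int n' * a)) *
      (cis (2 * pi * (of_int (m - m') * b) * t) * F (t - of_int (n - n') * a) * cnj (G t)))"
  proof (rule Bochner_Integration.integral_cong[OF refl])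
    fix t
    have "cis (2 * pi * (of_int m * b) * (of_int n' * a + 1 * t)) * cnj (cis (2 * pi * (of_int m' * b) * (of_int n' * a + 1 * t)))
        = cis (2 * pi * (of_int (m - m') * b) * (of_int n' * a)) * cis (2 * pi * (of_int (m - m') * b) * t)"
      by (simp add: cis_cnj cis_mult algebra_simps)
    moreover have "of_int n' * a + 1 * t - of_int n * a = t - of_int (n - n') * a"
      by (simp add: algebra_simps)
    moreover have "of_int n' * a + 1 * t - of_int n' * a = t" by simp
    ultimately show "cis (2 * pi * (of_int m * b) * (of_int n' * a + 1 * t)) * F (of_int n' * a + 1 * t - of_int n * a) *
       cnj (cis (2 * pi * (of_int m' * b) * (of_int n' * a + 1 * t)) * G (of_int n' * a + 1 * t - of_int n' * a)) =
      cis (2 * pi * (of_int (m - m') * b) * (of_int n' * a)) *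
      (cis (2 * pi * (of_int (m - m') * b) * t) * F (t - of_int (n - n') * a) * cnj (G t))"
      by (simp only: complex_cnj_mult mult_ac)
  qed
  also have "\<dots> = cis (2 * pi * (of_int (m - m') * b) * (of_int n' * a)) * cinner (gabor a b f (m - m', n - n')) g"
    using F G by (simp only: gabor_abs_L2R cinner_abs_L2R square_integrable_gabor integral_mult_right_zero)
  finally show ?thesis .
qed

section \<open>The orthonormal Gabor basis of a box window\<close>

text \<open>For \<open>b > 0\<close> the factor \<open>sqrt b\<close> gives unit norm, and half-open
  boxes tile the line under translation by \<open>1 / b\<close>. The offset \<alpha> allows the box
  to be placed over a prescribed interval.\<close>

definition box_window :: "real \<Rightarrow> real \<Rightarrow> L2R" where
  "box_window b \<alpha> = abs_L2R (\<lambda>t. indicator {\<alpha>..<\<alpha> + 1 / b} t *\<^sub>R complex_of_real (sqrt b))"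

lemma cinner_gabor_box_window:
  assumes "square_integrable H"
  shows "cinner (abs_L2R H) (gabor (1 / b) b (box_window b \<alpha>) (m, n)) =
    sqrt b * (LINT t:{\<alpha> + of_int n / b..<\<alpha> + of_int n / b + 1 / b}|lborel. H t * cis (2 * pi * (of_int (- m) * b) * t))"
proof -
  have "cinner (abs_L2R H) (gabor (1 / b) b (box_window b \<alpha>) (m, n)) =
      (LINT t|lborel. H t * cnj (cis (2 * pi * (of_int m * b) * t) *
        (indicator {\<alpha>..<\<alpha> + 1 / b} (t - of_int n * (1 / b)) *\<^sub>R complex_of_real (sqrt b))))"
    unfolding box_window_def gabor_abs_L2R[OF square_integrable_const_indicator]
    by (intro cinner_abs_L2R assms square_integrable_gabor square_integrable_const_indicator)
  also have "\<dots> = (LINT t|lborel. sqrt b * (indicator {\<alpha> + of_int n / b..<\<alpha> + of_int n / b + 1 / b} t *\<^sub>R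
      (H t * cis (2 * pi * (of_int (- m) * b) * t))))"
  proof (rule Bochner_Integration.integral_cong[OF refl])
    fix t
    have "(indicator {\<alpha>..<\<alpha> + 1 / b} (t - of_int n * (1 / b)) :: real) =
        indicator {\<alpha> + of_int n / b..<\<alpha> + of_int n / b + 1 / b} t"
      by (auto simp: indicator_def)
    then show "H t * cnj (cis (2 * pi * (of_int m * b) * t) *
        (indicator {\<alpha>..<\<alpha> + 1 / b} (t - of_int n * (1 / b)) *\<^sub>R complex_of_real (sqrt b))) =
      sqrt b * (indicator {\<alpha> + of_int n / b..<\<alpha> + of_int n / b + 1 / b} t *\<^sub>R
      (H t * cis (2 * pi * (of_int (- m) * b) * t)))"
      by (simp add: cis_cnj scaleR_conv_of_real)
  qed
  finally show ?thesis
    by (simp only: integral_mult_right_zero set_lebesgue_integral_def)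
qed

text \<open>After reduction to the second index 0, different translates have disjoint supports, and
  equal translates leave the integral of a character over one period.\<close>

lemma gabor_box_window_orthonormal:
  assumes "b > 0"
  shows "cinner (gabor (1 / b) b (box_window b \<alpha>) i) (gabor (1 / b) b (box_window b \<alpha>) j) =
    (if i = j then 1 else 0)"
proof -
  obtain m n where i: "i = (m, n)" by force
  obtain m' n' where j: "j = (m', n')" by force
  define k where "k = m - m'"
  define l where "l = n - n'"
  have "cinner (gabor (1 / b) b (box_window b \<alpha>) (k, l)) (gabor (1 / b) b (box_window b \<alpha>) (0, 0)) =
    sqrt b * (LINT t|lborel. indicator {\<alpha>..<\<alpha> + 1 / b} t *\<^sub>R
      (cis (2 * pi * (of_int k * b) * t) * (indicator {\<alpha>..<\<alpha> + 1 / b} (t - of_int l * (1 / b)) *\<^sub>R complex_of_real (sqrt b))))"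
    (is "_ = _ * ?I")
    unfolding box_window_def[of b \<alpha>, THEN arg_cong[where f="\<lambda>x. gabor (1/b) b x (k, l)"]]
      gabor_abs_L2R[OF square_integrable_const_indicator]
      cinner_gabor_box_window[OF square_integrable_gabor[OF square_integrable_const_indicator]]
    by (simp add: set_lebesgue_integral_def)
  also have "?I = (if l = 0 then sqrt b * (LINT t|lborel. indicator {\<alpha>..<\<alpha> + 1 / b} t *\<^sub>R cis (2 * pi * (of_int k * b) * t)) else 0)"
  proof (cases "l = 0")
    case True
    have "?I = (LINT t|lborel. complex_of_real (sqrt b) * (indicator {\<alpha>..<\<alpha> + 1 / b} t *\<^sub>R cis (2 * pi * (of_int k * b) * t)))"
      using True by (intro Bochner_Integration.integral_cong) (auto simp: indicator_def scaleR_conv_of_real)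
    then show ?thesis
      by (simp only: True integral_mult_right_zero if_True refl)
  next
    case False
    have "indicator {\<alpha>..<\<alpha> + 1 / b} t *\<^sub>R
      (cis (2 * pi * (of_int k * b) * t) * (indicator {\<alpha>..<\<alpha> + 1 / b} (t - of_int l * (1 / b)) *\<^sub>R complex_of_real (sqrt b))) = 0" for t
    proof -
      have "1 \<le> \<bar>of_int l :: real\<bar>" using False by linarith
      then have "1 / b \<le> \<bar>of_int l * (1 / b)\<bar>"
        using assms by (simp add: abs_mult divide_le_cancel)
      then show ?thesis by (auto simp: indicator_def abs_if split: if_splits)
    qed
    then show ?thesis
      by (simp only: False if_False integral_zero)
  qed
  also have "sqrt b * \<dots> = (if k = 0 \<and> l = 0 then 1 else 0)"
    using assms by (subst integral_cis_period[OF assms]) (simp add: scaleR_conv_of_real flip: of_real_mult)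
  finally have base: "cinner (gabor (1 / b) b (box_window b \<alpha>) (k, l)) (gabor (1 / b) b (box_window b \<alpha>) (0, 0)) = \<dots>" .
  show ?thesis
    unfolding i j cinner_gabor_gabor using base[unfolded gabor_zero] by (auto simp: k_def l_def)
qed

text \<open>On each tile \<open>J n\<close> the inner products are, up to \<open>sqrt b\<close>, all
  Fourier coefficients of \<open>H\<close>, so \<open>H\<close> vanishes almost everywhere there;
  countably many tiles cover the line.\<close>

lemma gabor_box_window_total:
  assumes "b > 0" and orth: "\<And>i. cinner h (gabor (1 / b) b (box_window b \<alpha>) i) = 0"
  shows "h = 0"
proof -
  obtain H where H: "square_integrable H" "h = abs_L2R H" by (rule L2R_cases)
  define J where "J n = {\<alpha> + of_int n / b..<\<alpha> + of_int n / b + 1 / b}" for n :: int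
  have "AE t in lborel. indicator (J n) t *\<^sub>R H t = 0" for n
  proof (rule AE_eq_0_if_fourier_coeffs_0[OF assms(1)])
    have "integrable lborel (\<lambda>t. H t * cnj (indicator (J n) t *\<^sub>R 1))"
      unfolding J_def by (intro square_integrable_imp_integrable H square_integrable_const_indicator)
    then show "integrable lborel (\<lambda>t. indicator (J n) t *\<^sub>R H t)"
      by (simp add: scaleR_conv_of_real mult.commute)
    show "indicator (J n) t *\<^sub>R H t = 0" if "t \<notin> {\<alpha> + of_int n / b..<\<alpha> + of_int n / b + 1 / b}" for t
      using that by (simp add: J_def)
    fix m :: int
    have "sqrt b * (LINT t:J n|lborel. H t * cis (2 * pi * (of_int (- (- m)) * b) * t)) = 0"
      using orth[of "(- m, n)"] unfolding H(2) cinner_gabor_box_window[OF H(1)] J_def .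
    then show "(LINT t|lborel. indicator (J n) t *\<^sub>R H t * cis (2 * pi * (of_int m * b) * t)) = 0"
      using assms(1) by (simp add: set_lebesgue_integral_def)
  qed
  then have "AE t in lborel. \<forall>n. indicator (J n) t *\<^sub>R H t = 0"
    by (subst AE_all_countable) auto
  then have "AE t in lborel. H t = 0"
  proof eventually_elim
    case (elim t)
    define n where "n = \<lfloor>(t - \<alpha>) * b\<rfloor>"
    have "of_int n \<le> (t - \<alpha>) * b" "(t - \<alpha>) * b < of_int n + 1"
      unfolding n_def by linarith+
    then have "t \<in> J n"
      using assms(1) by (auto simp: J_def field_simps)
    with elim[rule_format, of n] show ?case by simp
  qed
  then show ?thesis using H abs_L2R_eq_0 by simp
qed

text \<open>Read off from the expansion in the box-window basis: functions supported in
  \<open>J\<close> meet only the basis elements with \<open>n = 0\<close>, whose coefficients are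
  Fourier coefficients times \<open>sqrt b\<close>.\<close>

lemma fourier_parseval:
  assumes "b > 0" and F: "square_integrable F" and G: "square_integrable G"
    and J: "J \<in> sets borel" "J \<subseteq> {\<alpha>..<\<alpha> + 1 / b}"
  shows "((\<lambda>m::int. (LINT t:J|lborel. F t * cis (2 * pi * (of_int m * b) * t)) *
      cnj (LINT t:J|lborel. G t * cis (2 * pi * (of_int m * b) * t))) has_sum
    (LINT t:J|lborel. F t * cnj (G t)) / b) UNIV"
proof -
  define e where "e = gabor (1 / b) b (box_window b \<alpha>)"
  define x where "x = abs_L2R (\<lambda>t. indicator J t *\<^sub>R F t)"
  define y where "y = abs_L2R (\<lambda>t. indicator J t *\<^sub>R G t)"
  have coeff: "cinner (abs_L2R (\<lambda>t. indicator J t *\<^sub>R H t)) (e (m, n)) =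
      (if n = 0 then sqrt b * (LINT t:J|lborel. H t * cis (2 * pi * (of_int (- m) * b) * t)) else 0)"
    if "square_integrable H" for H m n
  proof -
    have "indicator {\<alpha> + of_int n / b..<\<alpha> + of_int n / b + 1 / b} t *\<^sub>R
        (indicator J t *\<^sub>R H t * cis (2 * pi * (of_int (- m) * b) * t)) =
        (if n = 0 then indicator J t *\<^sub>R (H t * cis (2 * pi * (of_int (- m) * b) * t)) else 0)" for t
    proof (cases "t \<in> J")
      case True
      then have t: "\<alpha> \<le> t" "t < \<alpha> + 1 / b" using J by auto
      have "n = 0" if "\<alpha> + of_int n / b \<le> t" "t < \<alpha> + of_int n / b + 1 / b"
      proof -
        have "of_int n / b < 1 / b" "- 1 / b < of_int n / b" using that t by auto
        then have "of_int n < (1 :: real)" "- 1 < (of_int n :: real)"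
          using assms(1) by (simp_all add: field_simps)
        then show ?thesis by linarith
      qed
      then show ?thesis using t by (auto simp: indicator_def)
    qed simp
    then show ?thesis
      unfolding e_def cinner_gabor_box_window[OF square_integrable_indicator[OF that J(1)]]
        set_lebesgue_integral_def by simp
  qed
  have "((\<lambda>i. cinner x (e i) *\<^sub>C e i) has_sum x) UNIV"
    unfolding e_def
    by (rule orthonormal_expansion[OF gabor_box_window_orthonormal[OF assms(1)] gabor_box_window_total[OF assms(1)]])
  then have "((\<lambda>i. cinner x (e i) * cinner (e i) y) has_sum cinner x y) UNIV"
    by (rule has_sum_cinner_expansion)
  \<comment> \<open>The sign in \<open>(- m, 0)\<close> undoes the conjugation of the character in
    the second argument of \<open>cinner\<close>.\<close>
  then have "((\<lambda>i. cinner x (e i) * cinner (e i) y) has_sum cinner x y) (range (\<lambda>m. (- m, 0)))"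
  proof (rule has_sum_cong_neutral[THEN iffD1, rotated -1])
    fix i :: "int \<times> int" assume i: "i \<in> UNIV - range (\<lambda>m. (- m, 0))"
    obtain m n where mn: "i = (m, n)" by force
    have "n \<noteq> 0"
    proof
      assume "n = 0"
      then have "i = (\<lambda>m. (- m, 0)) (- m)" using mn by simp
      with i show False by blast
    qed
    then show "cinner x (e i) * cinner (e i) y = 0"
      using coeff[OF F] by (simp add: mn x_def)
  qed auto
  then have "((\<lambda>m. cinner x (e (- m, 0)) * cinner (e (- m, 0)) y) has_sum cinner x y) UNIV"
    by (subst (asm) has_sum_reindex) (auto simp: inj_on_def o_def)
  moreover have "cinner x (e (- m, 0)) * cinner (e (- m, 0)) y =
      b * ((LINT t:J|lborel. F t * cis (2 * pi * (of_int m * b) * t)) *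
      cnj (LINT t:J|lborel. G t * cis (2 * pi * (of_int m * b) * t)))" for m
  proof -
    have sq: "complex_of_real (sqrt b) * complex_of_real (sqrt b) = complex_of_real b"
      using assms(1) by (simp flip: of_real_mult)
    have "cinner (e (- m, 0)) y = cnj (cinner y (e (- m, 0)))"
      by (rule cinner_commute)
    then have "cinner x (e (- m, 0)) * cinner (e (- m, 0)) y =
       (complex_of_real (sqrt b) * complex_of_real (sqrt b)) * ((LINT t:J|lborel. F t * cis (2 * pi * (of_int m * b) * t)) *
      cnj (LINT t:J|lborel. G t * cis (2 * pi * (of_int m * b) * t)))"
      using coeff[OF F, of "- m" 0] coeff[OF G, of "- m" 0] by (simp add: x_def y_def)
    then show ?thesis unfolding sq .
  qed
  moreover have "cinner x y = (LINT t:J|lborel. F t * cnj (G t))"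
    unfolding x_def y_def cinner_abs_L2R[OF square_integrable_indicator[OF F J(1)] square_integrable_indicator[OF G J(1)]]
      set_lebesgue_integral_def
    by (intro Bochner_Integration.integral_cong) (auto simp: indicator_def)
  ultimately have "((\<lambda>m. b * ((LINT t:J|lborel. F t * cis (2 * pi * (of_int m * b) * t)) *
      cnj (LINT t:J|lborel. G t * cis (2 * pi * (of_int m * b) * t)))) has_sum (LINT t:J|lborel. F t * cnj (G t))) UNIV"
    by (simp only:)
  from has_sum_cmult_right[OF this, of "1 / complex_of_real b"] show ?thesis
    using assms(1) by simp
qed

section \<open>Critical density and self-duality\<close>

text \<open>Slicing the expansion of the indicator of \<open>J\<close> along the modulations and summing each slice by
  Parseval's identity for Fourier series.\<close>

lemma gabor_dual_slice:
  assumes "a > 0" "b > 0" and F: "square_integrable F" and G: "square_integrable G"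
    and "riesz_basis (gabor a b (abs_L2R F))"
    and dual: "\<And>i j. cinner (gabor a b (abs_L2R F) i) (gabor a b (abs_L2R G) j) = (if i = j then 1 else 0)"
    and l: "0 \<le> l" "l \<le> 1 / b"
  shows "((\<lambda>n::int. (LINT t:{\<sigma>..<\<sigma> + l}|lborel. F (t - of_int n * a) * cnj (G (t - of_int n * a))) / b)
    has_sum complex_of_real l) UNIV"
proof -
  define J where "J = {\<sigma>..<\<sigma> + l}"
  define x where "x = abs_L2R (\<lambda>t. indicator J t *\<^sub>R 1)"
  define c where "c H m n = (LINT t:J|lborel. H (t - of_int n * a) * cis (2 * pi * (of_int m * b) * t))"
    for H :: "real \<Rightarrow> complex" and m n :: int
  have J: "J \<in> sets borel" "J \<subseteq> {\<sigma>..<\<sigma> + 1 / b}"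
    using l by (auto simp: J_def)
  have coeff: "cinner (gabor a b (abs_L2R H) (m, n)) x = c H m n" if H: "square_integrable H" for H m n
    unfolding x_def J_def gabor_abs_L2R[OF H]
      cinner_abs_L2R[OF square_integrable_gabor[OF H] square_integrable_const_indicator]
    by (simp add: c_def J_def set_lebesgue_integral_def scaleR_conv_of_real mult_ac)
  have "((\<lambda>i. cinner x (gabor a b (abs_L2R G) i) * cinner (gabor a b (abs_L2R F) i) x) has_sum cinner x x) UNIV"
    by (rule has_sum_cinner_expansion[OF biorthogonal_expansion[OF assms(5) dual]])
  moreover have "cinner x x = complex_of_real l"
  proof -
    have "cinner x x = (LINT t|lborel. indicator J t *\<^sub>R 1)"
      unfolding x_def J_def cinner_abs_L2R[OF square_integrable_const_indicator square_integrable_const_indicator]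
      by (intro Bochner_Integration.integral_cong) (auto simp: indicator_def)
    then show ?thesis using l by (simp add: J_def scaleR_conv_of_real)
  qed
  moreover have "cinner x (gabor a b (abs_L2R G) (m, n)) * cinner (gabor a b (abs_L2R F) (m, n)) x =
      c F m n * cnj (c G m n)" for m n
    unfolding coeff[OF F] by (subst cinner_commute) (simp add: coeff[OF G])
  then have "(\<lambda>i. cinner x (gabor a b (abs_L2R G) i) * cinner (gabor a b (abs_L2R F) i) x) =
      (\<lambda>(m, n). c F m n * cnj (c G m n))"
    by (auto simp: fun_eq_iff)
  ultimately have "((\<lambda>(m, n). c F m n * cnj (c G m n)) has_sum complex_of_real l) (UNIV \<times> UNIV)"
    by simp
  \<comment> \<open>The order is exchanged so that the modulations form the inner sum, which
    Parseval's identity evaluates for each translation; this uses that \<open>J\<close> fits into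
    one period.\<close>
  then have "((\<lambda>(n, m). c F m n * cnj (c G m n)) has_sum complex_of_real l) (UNIV \<times> UNIV)"
    by (subst (asm) has_sum_swap) simp
  then show ?thesis
  proof (rule has_sum_SigmaD)
    fix n :: int
    show "((\<lambda>m. case (n, m) of (n, m) \<Rightarrow> c F m n * cnj (c G m n)) has_sum
        (LINT t:{\<sigma>..<\<sigma> + l}|lborel. F (t - of_int n * a) * cnj (G (t - of_int n * a))) / b) UNIV"
      using fourier_parseval[OF assms(2) square_integrable_translate[OF F] square_integrable_translate[OF G] J]
      by (simp add: c_def J_def)
  qed
qed

text \<open>Translating back, the terms are integrals of \<open>P\<close> over intervals of length
  \<open>a\<close> that tile the line. Countable additivity needs a sequence, hence the enumeration
  by \<open>int_decode\<close>.\<close>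

lemma integral_sum_translates:
  fixes P :: "real \<Rightarrow> complex"
  assumes "a > 0" "integrable lborel P"
    and "((\<lambda>n::int. (LINT t:{0..<a}|lborel. P (t - of_int n * a))) has_sum S) UNIV"
  shows "integral\<^sup>L lborel P = S"
proof -
  define A where "A i = {- of_int (int_decode i) * a..<- of_int (int_decode i) * a + a}" for i
  have shift: "(LINT t:{0..<a}|lborel. P (t - of_int n * a)) = (LINT t:{- of_int n * a..<- of_int n * a + a}|lborel. P t)" for n :: int
    unfolding set_lebesgue_integral_def
    by (subst lborel_integral_real_affine[where c = 1 and t = "of_int n * a"])
      (auto simp: indicator_def intro!: Bochner_Integration.integral_cong)
  have "((\<lambda>i. (LINT t:A i|lborel. P t)) has_sum S) UNIV"
    using assms(3) has_sum_reindex_bij_betw[OF bij_int_decode,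
      of "\<lambda>n. (LINT t:{0..<a}|lborel. P (t - of_int n * a))" S]
    by (simp add: shift A_def)
  then have "(\<lambda>i. (LINT t:A i|lborel. P t)) sums S"
    by (rule has_sum_imp_sums)
  moreover have "(LINT t:(\<Union>i. A i)|lborel. P t) = (\<Sum>i. (LINT t:A i|lborel. P t))"
  proof (rule lebesgue_integral_countable_add)
    show "A i \<inter> A j = {}" if "i \<noteq> j" for i j
    proof (rule ccontr)
      assume "A i \<inter> A j \<noteq> {}"
      then have "\<bar>of_int (int_decode i) * a - of_int (int_decode j) * a\<bar> < a"
        by (auto simp: A_def)
      then have "\<bar>of_int (int_decode i) - of_int (int_decode j) :: real\<bar> * a < 1 * a"
        using assms(1) by (simp add: abs_mult flip: left_diff_distrib)
      then have "\<bar>of_int (int_decode i - int_decode j) :: real\<bar> < 1"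
        using assms(1) by (simp only: mult_less_cancel_right_pos of_int_diff)
      then have "int_decode i = int_decode j" by linarith
      with that show False by (simp add: int_decode_eq)
    qed
    show "set_integrable lborel (\<Union>i. A i) P"
      unfolding set_integrable_def using assms(2) by (intro integrable_mult_indicator) (auto simp: A_def)
  qed (auto simp: A_def)
  moreover have "(\<Union>i. A i) = UNIV"
  proof (intro equalityI subsetI UNIV_I)
    fix t
    define n where "n = - \<lfloor>t / a\<rfloor>"
    have "- of_int n \<le> t / a" "t / a < - of_int n + 1"
      unfolding n_def by linarith+
    then have "t \<in> A (int_encode n)"
      using assms(1) by (auto simp: A_def field_simps)
    then show "t \<in> (\<Union>i. A i)" by blast
  qed
  ultimately have "(LINT t:UNIV|lborel. P t) = S"
    by (simp only: sums_unique[symmetric])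
  then show ?thesis
    by (simp add: set_lebesgue_integral_def)
qed

lemma riesz_basis_gabor_critical:
  assumes "a > 0" "b > 0" and riesz: "riesz_basis (gabor a b f)"
  shows "a * b = 1"
proof -
  obtain g where g: "\<And>i. cinner (gabor a b f i) g = (if i = (0, 0) then 1 else 0)"
    using exists_biorthogonal[OF riesz] by blast
  \<comment> \<open>One biorthogonal vector suffices: the dual system is the Gabor system with
    window \<open>g\<close> and the same parameters.\<close>
  have dual: "cinner (gabor a b f i) (gabor a b g j) = (if i = j then 1 else 0)" for i j
    by (cases i; cases j) (auto simp: cinner_gabor_gabor g)
  obtain F where F: "square_integrable F" "f = abs_L2R F" by (rule L2R_cases)
  obtain G where G: "square_integrable G" "g = abs_L2R G" by (rule L2R_cases)
  define P where "P t = F t * cnj (G t)" for t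
  have P: "integrable lborel P"
    unfolding P_def by (rule square_integrable_imp_integrable[OF F(1) G(1)])
  have P_shift: "set_integrable lborel A (\<lambda>t. P (t - x))" if "A \<in> sets borel" for A x
    using lborel_integrable_real_affine[OF P, of 1 "- x"] that
    unfolding set_integrable_def by (intro integrable_mult_indicator) auto
  have "integral\<^sup>L lborel P = cinner f g"
    unfolding P_def F(2) G(2) by (rule cinner_abs_L2R[OF F(1) G(1), symmetric])
  also have "\<dots> = 1"
    using g[of "(0, 0)"] by (simp add: gabor_zero)
  finally have P1: "integral\<^sup>L lborel P = 1" .
  \<comment> \<open>\<open>[0, a)\<close> is cut into \<open>K\<close> pieces of length
    \<open>l = a / K\<close>; the choice of \<open>K\<close> makes \<open>l\<close> at most one
    period \<open>1 / b\<close>, as the slice identity requires.\<close>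
  obtain K :: nat where K: "a * b < real K"
    using reals_Archimedean2 by blast
  then have "K > 0" using assms(1,2) by (cases "K = 0") (auto simp: mult_less_0_iff)
  define l where "l = a / real K"
  have l: "0 \<le> l" "l \<le> 1 / b" "real K * l = a"
    using K \<open>K > 0\<close> assms(1,2) by (auto simp: l_def field_simps)
  have slices: "((\<lambda>n::int. (LINT t:{0..<real k * l}|lborel. P (t - of_int n * a)) / b) has_sum complex_of_real (real k * l)) UNIV" for k
  proof (induction k)
    case 0
    then show ?case by (simp add: set_lebesgue_integral_def)
  next
    case (Suc k)
    have "((\<lambda>n::int. (LINT t:{real k * l..<real k * l + l}|lborel. P (t - of_int n * a)) / b) has_sum complex_of_real l) UNIV"
      unfolding P_def using riesz dual unfolding F(2) G(2)
      by (intro gabor_dual_slice assms F G l) auto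
    from has_sum_add[OF Suc this]
    have "((\<lambda>n::int. ((LINT t:{0..<real k * l}|lborel. P (t - of_int n * a)) +
        (LINT t:{real k * l..<real k * l + l}|lborel. P (t - of_int n * a))) / b) has_sum complex_of_real (real (Suc k) * l)) UNIV"
      by (simp add: add_divide_distrib algebra_simps)
    moreover have "(LINT t:{0..<real k * l}|lborel. P (t - of_int n * a)) +
        (LINT t:{real k * l..<real k * l + l}|lborel. P (t - of_int n * a)) =
        (LINT t:{0..<real (Suc k) * l}|lborel. P (t - of_int n * a))" for n :: int
    proof -
      have "{0..<real (Suc k) * l} = {0..<real k * l} \<union> {real k * l..<real k * l + l}"
      proof -
        have "0 \<le> real k * l" using l(1) by simp
        moreover have "real (Suc k) * l = real k * l + l" by (simp add: algebra_simps)
        ultimately show ?thesis using l(1) by (simp only: ivl_disj_un_two(3) le_add_same_cancel1)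
      qed
      then show ?thesis
        by (simp only:) (subst set_integral_Un; auto intro: P_shift)
    qed
    ultimately show ?case by (simp only:)
  qed
  \<comment> \<open>With all \<open>K\<close> slices added up, the left-hand sum is the integral of
    \<open>P\<close>, which is 1, and the value is \<open>a * b\<close>.\<close>
  from has_sum_cmult_right[OF slices[of K, unfolded l(3)], of "complex_of_real b"]
  have "((\<lambda>n::int. (LINT t:{0..<a}|lborel. P (t - of_int n * a))) has_sum complex_of_real (a * b)) UNIV"
    using assms(2) by (simp add: mult.commute)
  from integral_sum_translates[OF assms(1) P this] P1
  have "complex_of_real (a * b) = complex_of_real 1" by simp
  then show ?thesis
    by (simp only: of_real_eq_iff)
qed

section \<open>Self-duality at critical density\<close>

lemma adjoint_gabor_critical:
  assumes "a > 0" "b > 0" "a * b = 1"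
  shows "adjoint_gabor a b f = gabor a b f"
proof -
  have "1 / a = b" "1 / b = a" using assms by (simp_all add: field_simps)
  then have "of_int m / a = of_int m * b" "of_int n / b = of_int n * a" for m n
    by (metis times_divide_eq_right mult.right_neutral)+
  then show ?thesis
    by (auto simp: adjoint_gabor_def gabor_def assms(3))
qed

lemma cinner_gabor_uminus:
  assumes "a * b = 1"
  shows "cinner (gabor a b f i) (gabor a b g (- j)) = cinner (gabor a b f (i + j)) g"
proof -
  obtain m n where i: "i = (m, n)" by force
  obtain m' n' where j: "j = (m', n')" by force
  have "2 * pi * (of_int (m - - m') * b) * (of_int (- n') * a) = 2 * pi * of_int ((m + m') * (- n')) * (a * b)"
    by simp
  then have "cis (2 * pi * (of_int (m - - m') * b) * (of_int (- n') * a)) = 1"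
    unfolding assms by (simp only: mult_1_right) (rule cis_multiple_2pi, simp)
  then show ?thesis
    unfolding i j uminus_Pair cinner_gabor_gabor by simp
qed

lemma gabor_self_R_dual:
  assumes "a > 0" "b > 0" and ab: "a * b = 1"
  defines "v \<equiv> \<lambda>i. gabor a b (box_window b 0) (- i)"
  shows "is_R_dual (gabor a b f) (gabor a b f) v v \<and> is_weak_R_dual (gabor a b f) (gabor a b f) v v"
proof -
  have a: "1 / b = a" using assms(1,2) ab by (simp add: field_simps)
  have on: "cinner (v i) (v j) = (if i = j then 1 else 0)" for i j
    using gabor_box_window_orthonormal[OF assms(2), of 0 "- i" "- j"] by (simp add: v_def a)
  have total: "h = 0" if "\<And>i. cinner h (v i) = 0" for h
  proof (rule gabor_box_window_total[OF assms(2)])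
    show "cinner h (gabor (1 / b) b (box_window b 0) i) = 0" for i
      using that[of "- i"] by (simp add: v_def a)
  qed
  have expand: "((\<lambda>i. cinner x (v i) *\<^sub>C v i) has_sum x) UNIV" for x
    using on total by (rule orthonormal_expansion)
  \<comment> \<open>By this symmetry, the coefficients prescribed for the dual at index
    \<open>j\<close> are the expansion coefficients of \<open>gabor a b f j\<close> in the basis
    \<open>v\<close>.\<close>
  have sym: "cinner (gabor a b f i) (v j) = cinner (gabor a b f j) (v i)" for i j
    by (simp add: v_def cinner_gabor_uminus[OF ab] add.commute)
  have basis: "orthonormal_basis v" using on total by (rule orthonormal_basisI)
  have parseval: "parseval_frame v" using expand by (rule orthonormal_parseval_frame)
  have summable: "(\<lambda>i. (cmod (cinner (gabor a b f i) (v j)))\<^sup>2) summable_on UNIV" for j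
    using parseval unfolding sym[of _ j] parseval_frame_def by (blast intro: has_sum_imp_summable)
  have dual: "((\<lambda>i. cinner (gabor a b f i) (v j) *\<^sub>C v i) has_sum gabor a b f j) UNIV" for j
    unfolding sym[of _ j] by (rule expand)
  have "((\<lambda>k. cinner (v k) (v i) * cinner (gabor a b f k) (v j)) has_sum cinner (gabor a b f i) (v j)) UNIV" for i j
    by (rule has_sum_finite_neutralI[where B = "{i}"]) (auto simp: on)
  then show ?thesis
    unfolding is_R_dual_def is_weak_R_dual_def using basis parseval summable dual by blast
qed

theorem theorem4p3:
  fixes a b :: real and f :: L2R
  assumes "a > 0" and "b > 0" and "riesz_basis (gabor a b f)"
  shows "(\<exists>u v. is_R_dual (adjoint_gabor a b f) (gabor a b f) u v \<and>
                is_weak_R_dual (adjoint_gabor a b f) (gabor a b f) u v) \<and>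
         (\<forall>u v. is_weak_R_dual (adjoint_gabor a b f) (gabor a b f) u v \<longrightarrow>
                orthonormal_basis u \<and> orthonormal_basis v)"
proof -
  have ab: "a * b = 1" using assms by (rule riesz_basis_gabor_critical)
  show ?thesis
    \<comment> \<open>The adjoint system is now the given one, so the same Riesz basis hypothesis
      serves for both the sequence and its weak R-dual.\<close>
    unfolding adjoint_gabor_critical[OF assms(1,2) ab]
    using gabor_self_R_dual[OF assms(1,2) ab] weak_R_dual_orthonormal[OF assms(3,3)] by blast
qed

end
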